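(* Let $r\ge1$, let $n_1,\dots,n_r$ be non-negative integers, $\mathbf n=(n_1,\dots,n_r)$, and let $a,b,c,d,x_1,\dots,x_r$ be nonzero complex parameters, generic subject to $a^2q^{2|\mathbf n|+1}=cd$. Then $$\sum_{\substack{0\le k_i\le n_i\\ i=1,\dots,r}}\frac{\Delta(\mathbf xq^{2\mathbf k};p)}{\Delta(\mathbf x;p)}\frac{(b,q/b;q,p)_{|\mathbf k|}}{(aq/c,aq/d;q,p)_{|\mathbf k|}}q^{|\mathbf k|}\prod_{i,j=1}^r\frac{(q^{-2n_j}x_i/x_j;q^2,p)_{k_i}}{(q^2x_i/x_j;q^2,p)_{k_i}}$$ $$\times\prod_{i=1}^r\left(\frac{\theta(ax_iq^{|\mathbf k|+2k_i};p)}{\theta(ax_i;p)}\frac{(ax_i;q,p)_{|\mathbf k|}}{(ax_iq^{2n_i+1};q,p)_{|\mathbf k|}}\frac{(cx_i,dx_i;q^2,p)_{k_i}}{(ax_iq^2/b,abx_iq;q^2,p)_{k_i}}\right)$$ $$=\frac{(aq^2/bc,abq/c;q^2,p)_{|\mathbf n|}}{(aq/c;q,p)_{2|\mathbf n|}}\prod_{i=1}^r\frac{(ax_iq;q,p)_{2n_i}}{(ax_iq^2/b,abx_iq;q^2,p)_{n_i}}.$$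
   Context: $p,q$ are complex numbers with $|p|<1$, $q\ne0$, and $q^k\notin p^{\mathbb Z}$ for all integers $k>0$ (if $p=0$: $q^k\ne1$). For $x\ne0$, $\theta(x;p)=\prod_{j=0}^\infty(1-p^jx)(1-p^{j+1}/x)$. Elliptic shifted factorials: $(a;q,p)_k=\prod_{j=0}^{k-1}\theta(aq^j;p)$ for $k\in\mathbb Z_{\ge0}$ (similarly with base $q^2$), and $(a_1,\dots,a_m;q,p)_k=(a_1;q,p)_k\cdots(a_m;q,p)_k$. For $\mathbf k=(k_1,\dots,k_r)$, $|\mathbf k|=k_1+\cdots+k_r$. For $\mathbf x=(x_1,\dots,x_r)$, $\Delta(\mathbf x;p)=\prod_{1\le i<j\le r}x_j\theta(x_i/x_j;p)$, and $\mathbf xq^{2\mathbf k}=(x_1q^{2k_1},\dots,x_rq^{2k_r})$. In expressions such as $aq^2/bc$, everything after the slash is in the denominator. All parameters are assumed generic so that no denominator vanishes. *)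

theory Defs
  imports "HOL-Analysis.Analysis"
begin

text \<open>
  The modified theta function. The library's infinite product converges (possibly to \<open>0\<close>) whenever
  \<open>norm p < 1\<close>, see \<open>convergent_theta_prod\<close> below. For \<open>p = 0\<close> the convention \<open>0 ^ 0 = 1\<close>
  gives \<open>theta 0 x = 1 - x\<close>.
\<close>

definition theta :: "complex \<Rightarrow> complex \<Rightarrow> complex" where
  "theta p x = (\<Prod>j. (1 - p ^ j * x) * (1 - p ^ Suc j / x))"

text \<open>\<open>efac q p a k\<close> stands for $(a; q, p)_k$, and \<open>efacs q p [a\<^sub>1, \<dots>, a\<^sub>m] k\<close> for
  $(a_1, \ldots, a_m; q, p)_k$.\<close>

definition efac :: "complex \<Rightarrow> complex \<Rightarrow> complex \<Rightarrow> nat \<Rightarrow> complex" where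
  "efac q p a k = (\<Prod>j<k. theta p (a * q ^ j))"

definition efacs :: "complex \<Rightarrow> complex \<Rightarrow> complex list \<Rightarrow> nat \<Rightarrow> complex" where
  "efacs q p as k = (\<Prod>a\<leftarrow>as. efac q p a k)"

text \<open>Vectors of length \<open>r\<close> are functions on \<open>nat\<close> of which only the values on \<open>{1..r}\<close> matter.\<close>

definition Delta :: "nat \<Rightarrow> complex \<Rightarrow> (nat \<Rightarrow> complex) \<Rightarrow> complex" where
  "Delta r p x = (\<Prod>(i, j) \<in> {(i, j). 1 \<le> i \<and> i < j \<and> j \<le> r}. x j * theta p (x i / x j))"

definition weight :: "nat \<Rightarrow> (nat \<Rightarrow> nat) \<Rightarrow> nat" where
  "weight r k = (\<Sum>i=1..r. k i)"

lemma convergent_theta_prod: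
  assumes "norm p < 1"
  shows "convergent_prod (\<lambda>j. (1 - p ^ j * x) * (1 - p ^ Suc j / (x :: complex)))"
proof -
  have s: "summable (\<lambda>j. norm (p ^ j))"
    using assms by (simp add: norm_power summable_geometric)
  have conv: "convergent_prod (\<lambda>j. 1 - p ^ j * y)" for y
  proof -
    have "summable (\<lambda>j. norm ((1 - p ^ j * y) - 1))"
      using summable_mult2[OF s, of "norm y"] by (simp add: norm_mult)
    then show ?thesis
      using abs_convergent_prod_conv_summable abs_convergent_prod_imp_convergent_prod by blast
  qed
  show ?thesis
    using convergent_prod_mult[OF conv[of x] conv[of "p / x"]] by (simp add: mult.commute)
qed

lemma theta_p_zero: "theta 0 x = 1 - x"
proof -
  have "theta 0 x = (\<Prod>j\<in>{0::nat}. (1 - 0 ^ j * x) * (1 - 0 ^ Suc j / x))"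
    unfolding theta_def by (rule prodinf_finite) auto
  then show ?thesis by simp
qed

end

theory Submission
  imports Defs "HOL-Complex_Analysis.Complex_Analysis"
begin

text \<open>
  After multiplication by $\prod_i (ax_iq^2/b, abx_iq;q^2,p)_{n_i}$, both sides are, as functions of $b$,
  linear combinations of products of $N = |\mathbf n|$ functions $\theta(sb)\theta(sq/b)$. By the
  Weierstrass relation such functions are homogeneous polynomials of degree $N$ in any two independent
  ones, so it suffices to compare the two sides at $N + 1$ points. At $b = 1$ only $\mathbf k = 0$
  contributes. At $b = ax_iq^{2m}$ with $1 \le m \le n_i$ the terms with $k_i < m$ vanish, and shifting
  $k_i$ by $m$ turns the rest into a multiple of the same sum with
  $(a, b, x_i, n_i)$ replaced by $(aq^m, ax_iq^m, x_iq^{2m}, n_i - m)$, which is known by induction on $N$.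
  These points are independent for all $a$ outside a countable set; the other values of $a$ follow by
  continuity, with $c$ fixed and $d = a^2q^{2N+1}/c$.
\<close>

section \<open>Theta functions\<close>

text \<open>The denominators in \<open>b\<close> vanish at every comparison point except
  \<open>b = 1\<close>, so the terms cannot be evaluated there as they stand. All of them are put
  over one denominator \<open>bden\<close>, independent of \<open>k\<close>, and only the numerators
  \<open>bnum\<close> and \<open>numer\<close> are compared. With \<open>b0\<close> the comparison
  point, the new \<open>b\<close> of the shifted sum is determined by
  \<open>a' * b' = a * b0\<close>. The balancing condition survives because (a q^m)^2 q^(2(N-m)+1)
  is again c d; so c and d stay fixed in the induction. Most factors of a shifted term split
  directly into a constant part and a factor of the new sum; the exceptions trade places, those in
  \<open>b\<close> with those belonging to the index i0. The multiple of the shifted sum is the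
  cleared term with k_i0 = m and all other k_i = 0; its evaluation is the bulk of the work with
  shifted factorials. The Weierstrass relation rests on the fact that a quotient without poles of
  two functions with the same multiplier under z \<mapsto> p z is constant; for p = 0 it is a
  rational identity.\<close>

lemma continuous_eq_off_countable:
  fixes f g :: "complex \<Rightarrow> complex"
  assumes "countable S" and "\<And>z. z \<notin> S \<Longrightarrow> f z = g z"
    and "isCont f w" "isCont g w"
  shows "f w = g w"
proof (rule ccontr)
  assume neq: "f w \<noteq> g w"
  have "isCont (\<lambda>z. f z - g z) w"
    using assms by (intro continuous_intros)
  then have "eventually (\<lambda>z. f z - g z \<noteq> 0) (nhds w)"
    using neq by (intro tendsto_imp_eventually_ne[of _ "f w - g w"])
      (auto simp: isCont_def tendsto_at_iff_tendsto_nhds[of "\<lambda>z. f z - g z"])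
  then obtain e where e: "e > 0" "\<And>z. dist z w < e \<Longrightarrow> f z \<noteq> g z"
    unfolding eventually_nhds_metric by auto
  have "ball w e \<subseteq> S"
  proof
    fix z assume "z \<in> ball w e"
    then show "z \<in> S"
      using e(2)[of z] assms(2)[of z] by (auto simp: dist_commute)
  qed
  then show False
    using assms(1) countable_subset uncountable_ball e(1) by blast
qed

text \<open>The infinite shifted factorial (x; p)_\<infinity>. It is entire in \<open>x\<close>, and
  theta is a product of two of its values, so the zeros and the holomorphy of theta are read off
  from it.\<close>

definition qpoch :: "complex \<Rightarrow> complex \<Rightarrow> complex" where
  "qpoch p x = (\<Prod>j. 1 - p ^ j * x)"

context
  fixes p :: complex
  assumes p: "norm p < 1"
begin

lemma convergent_qpoch: "convergent_prod (\<lambda>j. 1 - p ^ j * x)"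
proof -
  have "summable (\<lambda>j. norm (p ^ j))"
    using p by (simp add: norm_power summable_geometric)
  then have "summable (\<lambda>j. norm ((1 - p ^ j * x) - 1))"
    using summable_mult2[of "\<lambda>j. norm (p ^ j)" "norm x"] by (simp add: norm_mult)
  then show ?thesis
    using abs_convergent_prod_conv_summable abs_convergent_prod_imp_convergent_prod by blast
qed

lemma theta_eq_qpoch: "theta p x = qpoch p x * qpoch p (p / x)"
  unfolding theta_def qpoch_def
  by (subst prodinf_mult[OF convergent_qpoch convergent_qpoch]) (simp add: mult.commute)

lemma has_prod_qpoch: "(\<lambda>j. 1 - p ^ j * x) has_prod qpoch p x"
  unfolding qpoch_def by (rule convergent_prod_has_prod[OF convergent_qpoch])

lemma qpoch_eq_0_iff: "qpoch p x = 0 \<longleftrightarrow> (\<exists>j. p ^ j * x = 1)"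
  unfolding has_prod_eq_0_iff[OF has_prod_qpoch] image_iff by auto

lemma qpoch_rec: "qpoch p x = (1 - x) * qpoch p (p * x)"
proof (cases "x = 1")
  case True
  then show ?thesis
    using qpoch_eq_0_iff[of x] by (auto intro: exI[of _ 0])
next
  case False
  then show ?thesis
    using prodinf_split_head[OF convergent_qpoch, of x] unfolding qpoch_def
    by (simp add: field_simps)
qed

text \<open>On the disc of radius R around 0 the terms p^j x are bounded by the summable |p|^j R, so
  the partial products converge uniformly; the closed disc of radius 1 around any z lies in such a
  disc.\<close>

lemma holomorphic_qpoch: "qpoch p holomorphic_on UNIV"
proof (rule holomorphic_uniform_sequence[where f = "\<lambda>N x. \<Prod>j<N. 1 - p ^ j * x"])
  fix z :: complex
  define R where "R = norm z + 1"
  have "uniformly_convergent_on (cball 0 R) (\<lambda>N x. \<Prod>j<N. 1 - p ^ j * x)"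
  proof (rule uniformly_convergent_on_prod')
    show "uniformly_convergent_on (cball 0 R) (\<lambda>N x. \<Sum>j<N. norm (1 - p ^ j * x - 1))"
    proof (rule Weierstrass_m_test')
      fix j and x :: complex assume "x \<in> cball 0 R"
      then show "norm (norm (1 - p ^ j * x - 1)) \<le> norm p ^ j * R"
        by (auto simp: norm_mult norm_power intro!: mult_left_mono)
    next
      show "summable (\<lambda>j. norm p ^ j * R)"
        using p by (intro summable_mult2 summable_geometric) auto
    qed
  qed (auto intro!: continuous_intros)
  then have "uniform_limit (cball 0 R) (\<lambda>N x. \<Prod>j<N. 1 - p ^ j * x)
      (\<lambda>x. lim (\<lambda>N. \<Prod>j<N. 1 - p ^ j * x)) sequentially"
    using uniformly_convergent_uniform_limit_iff by blast
  moreover have "lim (\<lambda>N. \<Prod>j<N. 1 - p ^ j * x) = qpoch p x" for x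
    by (intro limI has_prod_imp_tendsto' has_prod_qpoch)
  ultimately have "uniform_limit (cball 0 R) (\<lambda>N x. \<Prod>j<N. 1 - p ^ j * x) (qpoch p) sequentially"
    by simp
  moreover have "cball z 1 \<subseteq> cball 0 R"
  proof
    fix y assume "y \<in> cball z 1"
    then show "y \<in> cball 0 R"
      using norm_triangle_ineq2[of y z] by (simp add: R_def dist_norm norm_minus_commute)
  qed
  ultimately have "uniform_limit (cball z 1) (\<lambda>N x. \<Prod>j<N. 1 - p ^ j * x) (qpoch p) sequentially"
    by (rule uniform_limit_on_subset)
  then show "\<exists>d>0. cball z d \<subseteq> UNIV \<and>
      uniform_limit (cball z d) (\<lambda>N x. \<Prod>j<N. 1 - p ^ j * x) (qpoch p) sequentially"
    by (intro exI[of _ 1]) auto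
qed (auto intro!: holomorphic_intros)

lemma holomorphic_qpoch_compose [holomorphic_intros]:
  "f holomorphic_on A \<Longrightarrow> (\<lambda>z. qpoch p (f z)) holomorphic_on A"
  using holomorphic_on_compose[of f A "qpoch p"] holomorphic_on_subset[OF holomorphic_qpoch]
  by (auto simp: o_def)

lemma holomorphic_theta [holomorphic_intros]:
  assumes "f holomorphic_on A" "\<And>z. z \<in> A \<Longrightarrow> f z \<noteq> 0"
  shows "(\<lambda>z. theta p (f z)) holomorphic_on A"
  unfolding theta_eq_qpoch using assms by (intro holomorphic_intros) auto

lemma theta_field_differentiable:
  assumes "x \<noteq> 0"
  shows "theta p field_differentiable (at x)"
proof (rule holomorphic_on_imp_differentiable_at)
  show "theta p holomorphic_on - {0}"
    using holomorphic_theta[of "\<lambda>z. z" "- {0}"] by simp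
qed (use assms in auto)

lemma isCont_theta:
  assumes "isCont f z" "f z \<noteq> 0"
  shows "isCont (\<lambda>z. theta p (f z)) z"
  using assms theta_field_differentiable
  by (intro isCont_o2[OF assms(1)] field_differentiable_imp_continuous_at)

section \<open>Functional equations and zeros of theta\<close>

lemma theta_one [simp]: "theta p 1 = 0"
  using qpoch_rec[of 1] by (simp add: theta_eq_qpoch)

text \<open>Splitting off the factor j = 0 leaves the product
  \<open>qpoch p (p * x) * qpoch p (p / x)\<close> on both sides, multiplied by 1 - 1/x and by 1 -
  x.\<close>

lemma theta_inverse:
  assumes "x \<noteq> 0"
  shows "theta p (1 / x) = - theta p x / x"
proof -
  have 1: "theta p (1 / x) = ((1 - 1 / x) * qpoch p (p / x)) * qpoch p (p * x)"
    using qpoch_rec[of "1 / x"] by (simp add: theta_eq_qpoch)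
  have 2: "theta p x = ((1 - x) * qpoch p (p * x)) * qpoch p (p / x)"
    using qpoch_rec[of x] by (simp add: theta_eq_qpoch)
  show ?thesis
    unfolding 1 2 using assms by (simp add: field_simps)
qed

lemma theta_swap:
  assumes "x \<noteq> 0" "y \<noteq> 0"
  shows "theta p (x / y) = - (x / y) * theta p (y / x)"
  using theta_inverse[of "y / x"] assms by (simp add: field_simps)

lemma theta_swap_eq_0_iff:
  assumes "x \<noteq> 0" "y \<noteq> 0"
  shows "theta p (x / y) = 0 \<longleftrightarrow> theta p (y / x) = 0"
  by (subst theta_swap[OF assms]) (use assms in simp)

lemma theta_period:
  assumes "x \<noteq> 0" "p \<noteq> 0"
  shows "theta p (p * x) = - theta p x / x"
proof -
  have "theta p (p * x) = qpoch p (1 / x) * qpoch p (p * x)"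
    using assms by (simp add: theta_eq_qpoch)
  also have "\<dots> = theta p (1 / x)"
    by (simp add: theta_eq_qpoch)
  finally show ?thesis
    using theta_inverse assms by simp
qed

text \<open>The two \<open>qpoch\<close> factors vanish at the nonpositive and at the positive
  powers of p. Since \<open>0 powi 0 = 1\<close>, the case p = 0 is covered, where 1 is the only
  zero.\<close>

lemma theta_eq_0_imp:
  assumes "theta p x = 0" "x \<noteq> 0"
  shows "\<exists>m::int. x = p powi m"
proof -
  have "(\<exists>j. p ^ j * x = 1) \<or> (\<exists>j. p ^ j * (p / x) = 1)"
    using assms by (simp add: theta_eq_qpoch qpoch_eq_0_iff)
  then show ?thesis
  proof (elim disjE exE)
    fix j assume "p ^ j * x = 1"
    then have "x = p powi (- int j)"
      by (cases "p ^ j = 0") (auto simp: power_int_minus field_simps)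
    then show ?thesis ..
  next
    fix j assume "p ^ j * (p / x) = 1"
    then have "x = p powi int (Suc j)"
      using assms(2) by (simp only: power_int_of_nat) (simp add: field_simps)
    then show ?thesis ..
  qed
qed

lemma countable_theta_zeros: "countable {x. theta p x = 0}"
proof (rule countable_subset)
  show "{x. theta p x = 0} \<subseteq> insert 0 (range (\<lambda>m::int. p powi m))"
  proof
    fix x assume "x \<in> {x. theta p x = 0}"
    then show "x \<in> insert 0 (range (\<lambda>m::int. p powi m))"
      using theta_eq_0_imp[of x] by (cases "x = 0") auto
  qed
  show "countable (insert 0 (range (\<lambda>m::int. p powi m)))"
    by (intro countable_insert countable_image countableI_type)
qed

text \<open>All zeros are simple: theta is (1 - x) g(x) with g(1) the square of
  \<open>qpoch p p\<close>, which is nonzero, and the functional equation under x \<mapsto> p x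
  carries simplicity from 1 to all of p^Z.\<close>

lemma theta_deriv_nonzero:
  assumes "p \<noteq> 0" "theta p x = 0" "x \<noteq> 0" "(theta p has_field_derivative D) (at x)"
  shows "D \<noteq> 0"
proof -
  let ?S = "\<lambda>z. \<forall>D. (theta p has_field_derivative D) (at z) \<longrightarrow> D \<noteq> 0"
  have S1: "?S 1"
  proof (intro allI impI)
    fix D assume D: "(theta p has_field_derivative D) (at 1)"
    define g where "g = (\<lambda>x. qpoch p (p * x) * qpoch p (p / x))"
    have eq: "theta p = (\<lambda>x. (1 - x) * g x)"
      by (rule ext, subst theta_eq_qpoch, subst qpoch_rec) (simp add: g_def)
    have "g holomorphic_on - {0}"
      unfolding g_def by (intro holomorphic_intros) auto
    then obtain D' where D': "(g has_field_derivative D') (at 1)"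
      using holomorphic_on_imp_differentiable_at[of g "- {0}" 1]
      by (auto simp: field_differentiable_def)
    have "((\<lambda>x. (1 - x) * g x) has_field_derivative - g 1) (at 1)"
      by (rule derivative_eq_intros D' refl | simp)+
    then have "D = - g 1"
      using D eq DERIV_unique by metis
    moreover have "p ^ j * p \<noteq> 1" for j
    proof -
      have "norm (p ^ j * p) \<le> 1 * norm p"
        unfolding norm_mult norm_power using p by (intro mult_right_mono power_le_one) auto
      then show ?thesis using p by auto
    qed
    then have "qpoch p p \<noteq> 0"
      using qpoch_eq_0_iff by auto
    ultimately show "D \<noteq> 0" by (simp add: g_def)
  qed
  have step: "?S z \<longleftrightarrow> ?S (p * z)" if z: "z \<noteq> 0" "theta p z = 0" for z
  proof -
    obtain D1 D2 where D: "(theta p has_field_derivative D1) (at z)"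
        "(theta p has_field_derivative D2) (at (p * z))"
      using theta_field_differentiable[of z] theta_field_differentiable[of "p * z"] z \<open>p \<noteq> 0\<close>
      unfolding field_differentiable_def by auto
    \<comment> \<open>Both sides of theta(p w) = - theta(w) / w are differentiated at a zero z,
      where the contribution of 1 / w drops out.\<close>
    have "((\<lambda>w. theta p (p * w)) has_field_derivative D2 * p) (at z)"
      by (rule DERIV_chain2[of "theta p" D2 "(*) p", OF D(2)]) (auto intro!: derivative_eq_intros)
    moreover have "((\<lambda>w. - theta p w / w) has_field_derivative - D1 / z) (at z)"
      using z D(1) by (auto intro!: derivative_eq_intros simp: field_simps power2_eq_square)
    then have "((\<lambda>w. theta p (p * w)) has_field_derivative - D1 / z) (at z)"
    proof (rule has_field_derivative_transform_within_open[where S = "- {0}"])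
    qed (use z \<open>p \<noteq> 0\<close> in \<open>auto simp: theta_period\<close>)
    ultimately have "D2 * p = - D1 / z"
      using DERIV_unique by blast
    then have "D1 = 0 \<longleftrightarrow> D2 = 0"
      using z \<open>p \<noteq> 0\<close> by auto
    then show ?thesis
      using D DERIV_unique by blast
  qed
  have zero: "theta p (p powi m) = 0 \<and> ?S (p powi m)" for m
  proof (induction m rule: int_induct[where k = 0])
    case base
    then show ?case using S1 by simp
  next
    case (step1 i)
    then show ?case
      using step[of "p powi i"] theta_period[of "p powi i"] \<open>p \<noteq> 0\<close>
      by (simp add: power_int_add mult.commute)
  next
    case (step2 i)
    then show ?case
      using step[of "p powi (i - 1)"] theta_period[of "p powi (i - 1)"] \<open>p \<noteq> 0\<close>
      by (simp add: power_int_diff)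
  qed
  obtain m where "x = p powi m"
    using theta_eq_0_imp assms by blast
  then show ?thesis
    using zero assms by blast
qed

end

section \<open>The Weierstrass three-term relation\<close>

text \<open>Every value of G is taken on the compact annulus |p| \<le> |z| \<le> 1, a fundamental
  region for multiplication by p. Hence G composed with exp is a bounded entire function, and
  Liouville applies.\<close>

lemma periodic_holomorphic_constant:
  fixes G :: "complex \<Rightarrow> complex"
  assumes p: "norm p < 1" "p \<noteq> 0"
    and hol: "G holomorphic_on - {0}" and per: "\<And>z. z \<noteq> 0 \<Longrightarrow> G (p * z) = G z"
  shows "\<exists>C. \<forall>z. z \<noteq> 0 \<longrightarrow> G z = C"
proof -
  have powi: "G (p powi m * z) = G z" if "z \<noteq> 0" for m z
  proof (induction m rule: int_induct[where k = 0])
    case (step1 i)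
    then show ?case
      using per[of "p powi i * z"] that p by (simp add: power_int_add mult_ac)
  next
    case (step2 i)
    then show ?case
      using per[of "p powi (i - 1) * z"] that p by (simp add: power_int_diff)
  qed simp
  define A where "A = cball 0 1 - ball (0 :: complex) (norm p)"
  have "compact A"
    unfolding A_def by (intro compact_diff) auto
  moreover have "continuous_on A G"
    using p by (intro holomorphic_on_imp_continuous_on holomorphic_on_subset[OF hol]) (auto simp: A_def)
  ultimately have "bounded (G ` A)"
    by (intro compact_imp_bounded compact_continuous_image)
  moreover have "range (\<lambda>w. G (exp w)) \<subseteq> G ` A"
  proof safe
    fix w :: complex
    \<comment> \<open>Here |exp w| = |p|^t, and multiplication by p^m brings the exponent into [0,
      1), hence the point into the annulus.\<close>
    define t where "t = Re w / ln (norm p)"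
    define m where "m = - \<lfloor>t\<rfloor>"
    have ln: "ln (norm p) < 0" using p by simp
    have "norm p powr t = norm (exp w)"
      using p ln by (simp add: powr_def t_def)
    moreover have "norm p powr m = norm (p powi m)"
      using p by (simp add: powr_real_of_int' norm_power_int)
    ultimately have "norm (p powi m * exp w) = norm p powr (m + t)"
      unfolding powr_add norm_mult by simp
    moreover have "0 \<le> m + t" "m + t \<le> 1"
      unfolding m_def by linarith+
    ultimately have "norm (p powi m * exp w) \<le> 1" "norm p \<le> norm (p powi m * exp w)"
      using p powr_mono'[of 0 "m + t" "norm p"] powr_mono'[of "m + t" 1 "norm p"] by auto
    then have "p powi m * exp w \<in> A"
      by (auto simp: A_def)
    then show "G (exp w) \<in> G ` A"
      using powi[of "exp w" m] by (metis exp_not_eq_zero image_eqI)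
  qed
  ultimately have "bounded (range (\<lambda>w. G (exp w)))"
    using bounded_subset by blast
  moreover have "(\<lambda>w. G (exp w)) holomorphic_on UNIV"
  proof -
    have "exp ` UNIV \<subseteq> - {0 :: complex}" by auto
    then show ?thesis
      using holomorphic_on_compose_gen[OF holomorphic_on_exp hol] unfolding o_def by blast
  qed
  ultimately have "(\<lambda>w. G (exp w)) constant_on UNIV"
    by (intro Liouville_theorem)
  then show ?thesis
    unfolding constant_on_def by (metis UNIV_I exp_Ln)
qed

text \<open>The quotient F / D is invariant under z \<mapsto> p z because the multipliers agree, and
  it has no poles because the zeros of D are simple and shared by F. \<open>remove_sings\<close>
  fills the removable gaps.\<close>

lemma quasiperiodic_proportional:
  fixes F D m :: "complex \<Rightarrow> complex"
  assumes p: "norm p < 1" "p \<noteq> 0"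
    and F: "F holomorphic_on - {0}" "\<And>z. z \<noteq> 0 \<Longrightarrow> F (p * z) = m z * F z"
    and D: "D holomorphic_on - {0}" "\<And>z. z \<noteq> 0 \<Longrightarrow> D (p * z) = m z * D z"
    and m: "\<And>z. z \<noteq> 0 \<Longrightarrow> m z \<noteq> 0"
    and zeros: "\<And>z. z \<noteq> 0 \<Longrightarrow> D z = 0 \<Longrightarrow> F z = 0 \<and> deriv D z \<noteq> 0"
  shows "\<exists>C. \<forall>z. z \<noteq> 0 \<longrightarrow> F z = C * D z"
proof -
  define f where "f = (\<lambda>z. F z / D z)"
  define G where "G = remove_sings f"
  have analytic: "F analytic_on {z}" "D analytic_on {z}" if "z \<noteq> 0" for z
    using F(1) D(1) that analytic_on_open[of "- {0::complex}"] 
    by (auto intro: analytic_on_subset[where S = "- {0}"])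
  have lim: "\<exists>c. f \<midarrow>z\<rightarrow> c" if z: "z \<noteq> 0" for z
  proof (cases "D z = 0")
    case True
    have "(F has_field_derivative deriv F z) (at z)" "(D has_field_derivative deriv D z) (at z)"
      using F(1) D(1) z by (auto intro: holomorphic_derivI[where S = "- {0}"])
    then show ?thesis
      unfolding f_def using zeros[OF z True] True by (blast intro: lhopital_complex_simple)
  next
    case False
    have "isCont f z"
      unfolding f_def using False analytic[OF z]
      by (intro continuous_intros analytic_at_imp_isCont) auto
    then show ?thesis unfolding isCont_def by blast
  qed
  have G: "f \<midarrow>z\<rightarrow> G z" if "z \<noteq> 0" for z
    using lim[OF that] remove_sings_eqI[of f _ z] unfolding G_def by auto
  have "G analytic_on {z}" if "z \<noteq> 0" for z
    unfolding G_def
  proof (rule remove_sings_analytic_at)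
    show "f \<midarrow>z\<rightarrow> G z" by (rule G[OF that])
    show "isolated_singularity_at f z"
      unfolding f_def using analytic[OF that]
      by (intro singularity_intros isolated_singularity_at_analytic not_essential_analytic)
  qed
  then have "G holomorphic_on - {0}"
    by (intro analytic_imp_holomorphic) (auto simp: analytic_on_analytic_at[of G "- {0}"])
  moreover have "G (p * z) = G z" if z: "z \<noteq> 0" for z
  proof -
    have "((\<lambda>w. f (p * w)) \<longlongrightarrow> G (p * z)) (at z)"
    proof (rule tendsto_compose_eventually[OF G])
      show "(\<lambda>w. p * w) \<midarrow>z\<rightarrow> p * z" by (intro tendsto_intros)
      show "\<forall>\<^sub>F w in at z. p * w \<noteq> p * z"
        using p by (simp add: eventually_at_filter)
    qed (use z p in auto)
    moreover have "\<forall>\<^sub>F w in at z. f (p * w) = f w"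
    proof (rule eventually_mono)
      show "\<forall>\<^sub>F w in at z. w \<in> - {0}"
        using z by (intro eventually_at_in_open') auto
    qed (simp add: f_def F D m)
    ultimately have "f \<midarrow>z\<rightarrow> G (p * z)"
      by (rule Lim_transform_eventually)
    then show ?thesis
      using G[OF z] LIM_unique by blast
  qed
  ultimately obtain C where C: "\<And>z. z \<noteq> 0 \<Longrightarrow> G z = C"
    using periodic_holomorphic_constant[OF p] by metis
  have "F z = C * D z" if z: "z \<noteq> 0" for z
  proof (cases "D z = 0")
    case False
    then have "f analytic_on {z}"
      unfolding f_def using analytic[OF z] by (intro analytic_intros) auto
    then show ?thesis
      using C[OF z] False unfolding G_def by (auto simp: f_def field_simps)
  qed (use zeros z in auto)
  then show ?thesis by blast
qed

section \<open>Quasi-periodicity in x and the three-term relation\<close>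

context
  fixes p :: complex
  assumes p: "norm p < 1"
begin

text \<open>The multiplier 1 / x^2 does not depend on \<open>u\<close>, so linear combinations of
  such products with different \<open>u\<close> can be compared with a single one.\<close>

lemma theta_product_period:
  assumes "p \<noteq> 0" "x \<noteq> 0" "u \<noteq> 0"
  shows "theta p (p * x * u) * theta p (p * x / u) = 1 / x\<^sup>2 * (theta p (x * u) * theta p (x / u))"
proof -
  have 1: "theta p (p * x * u) = - theta p (x * u) / (x * u)"
    using theta_period[OF p, of "x * u"] assms by (simp add: mult.assoc)
  have 2: "theta p (p * x / u) = - theta p (x / u) / (x / u)"
    using theta_period[OF p, of "x / u"] assms by simp
  show ?thesis
    unfolding 1 2 using assms by (simp add: field_simps power2_eq_square)
qed

lemma theta_product_swap:
  assumes "x \<noteq> 0" "u \<noteq> 0"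
  shows "theta p (u * x) * theta p (u / x) = - (u / x) * (theta p (x * u) * theta p (x / u))"
  using theta_swap[OF p, of u x] assms by (simp add: mult.commute)

text \<open>As functions of x both sides have the multiplier 1 / x^2. The left side vanishes at u
  and 1 / u, hence at all zeros of theta(x u) theta(x / u), and the first genericity condition makes
  these zeros simple. So the two sides are proportional; the constant is found at x = v, where the
  subtracted term vanishes and the other two conditions allow the division.\<close>

lemma theta_three_term_generic:
  assumes nz: "p \<noteq> 0" "x \<noteq> 0" "y \<noteq> 0" "u \<noteq> 0" "v \<noteq> 0"
    and gen: "theta p (u\<^sup>2) \<noteq> 0" "theta p (u * v) \<noteq> 0" "theta p (u / v) \<noteq> 0"
  shows "theta p (x * y) * theta p (x / y) * (theta p (u * v) * theta p (u / v))
    - theta p (x * v) * theta p (x / v) * (theta p (u * y) * theta p (u / y))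
    = u / y * (theta p (y * v) * theta p (y / v)) * (theta p (x * u) * theta p (x / u))"
proof -
  define h where "h = (\<lambda>u x. theta p (x * u) * theta p (x / u))"
  define F where "F = (\<lambda>x. h y x * h v u - h v x * h y u)"
  have h_hol: "h w holomorphic_on - {0}" if "w \<noteq> 0" for w
    unfolding h_def using that by (intro holomorphic_intros holomorphic_theta[OF p]) auto
  have h_per: "h w (p * z) = 1 / z\<^sup>2 * h w z" if "w \<noteq> 0" "z \<noteq> 0" for w z
    using theta_product_period[of z w] that nz by (simp add: h_def)
  have F_per: "F (p * z) = 1 / z\<^sup>2 * F z" if "z \<noteq> 0" for z
    using nz that by (simp add: F_def h_per algebra_simps)
  have "F u = 0" by (simp add: F_def)
  have h_inv: "h w (1 / u) = h w u / u\<^sup>2" if "w \<noteq> 0" for w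
  proof -
    have 1: "theta p (1 / u * w) = - theta p (u / w) / (u / w)"
      using theta_inverse[OF p, of "u / w"] that nz by simp
    have 2: "theta p (1 / u / w) = - theta p (u * w) / (u * w)"
      using theta_inverse[OF p, of "u * w"] that nz by simp
    show ?thesis
      unfolding h_def 1 2 using that nz by (simp add: field_simps power2_eq_square)
  qed
  have "F (1 / u) = 0"
    using h_inv[of y] h_inv[of v] nz by (simp add: F_def)
  have F_powi: "F (p powi m * z) = 0" if "z \<noteq> 0" "F z = 0" for m z
  proof (induction m rule: int_induct[where k = 0])
    case (step1 i)
    then show ?case
      using F_per[of "p powi i * z"] that nz by (simp add: power_int_add mult_ac)
  next
    case (step2 i)
    then show ?case
      using F_per[of "p powi (i - 1) * z"] that nz by (simp add: power_int_diff)
  qed (use that in simp)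
  \<comment> \<open>Used contrapositively: theta(u^2) \<noteq> 0 keeps u^2 out of p^Z, so the orbits
    of u and of 1 / u under p^Z are disjoint and only one term of the product rule survives at each
    zero.\<close>
  have "theta p (p powi m) = 0" for m
  proof (induction m rule: int_induct[where k = 0])
    case base
    then show ?case by (simp add: p)
  next
    case (step1 i)
    then show ?case
      using theta_period[OF p, of "p powi i"] nz by (simp add: power_int_add mult.commute)
  next
    case (step2 i)
    then show ?case
      using theta_period[OF p, of "p powi (i - 1)"] nz by (simp add: power_int_diff)
  qed
  then have u2: "u\<^sup>2 \<noteq> p powi m" for m
    using gen(1) by metis
  have "\<exists>C. \<forall>z. z \<noteq> 0 \<longrightarrow> F z = C * h u z"
  proof (rule quasiperiodic_proportional[where m = "\<lambda>z. 1 / z\<^sup>2"])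
    show "F holomorphic_on - {0}"
      unfolding F_def using nz by (intro holomorphic_intros h_hol) auto
    fix z assume z: "z \<noteq> 0" and zero: "h u z = 0"
    obtain D1 D2 where D: "(theta p has_field_derivative D1) (at (z * u))"
      "(theta p has_field_derivative D2) (at (z / u))"
      using theta_field_differentiable[OF p, of "z * u"] theta_field_differentiable[OF p, of "z / u"]
        z nz unfolding field_differentiable_def by auto
    have "((\<lambda>x. theta p (x * u)) has_field_derivative D1 * u) (at z)"
      by (rule DERIV_chain2[of "theta p" D1 "\<lambda>x. x * u", OF D(1)]) (auto intro!: derivative_eq_intros)
    moreover have "((\<lambda>x. theta p (x / u)) has_field_derivative D2 * (1 / u)) (at z)"
      using nz by (intro DERIV_chain2[of "theta p" D2 "\<lambda>x. x / u", OF D(2)])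
        (auto intro!: derivative_eq_intros)
    ultimately have "(h u has_field_derivative D1 * u * theta p (z / u) + D2 * (1 / u) * theta p (z * u)) (at z)"
      unfolding h_def by (rule DERIV_mult)
    then have deriv: "deriv (h u) z = D1 * u * theta p (z / u) + D2 * (1 / u) * theta p (z * u)"
      by (rule DERIV_imp_deriv)
    have not_both: "\<not> (theta p (z * u) = 0 \<and> theta p (z / u) = 0)"
    proof
      assume "theta p (z * u) = 0 \<and> theta p (z / u) = 0"
      then obtain k l where "z * u = p powi k" "z / u = p powi l"
        using theta_eq_0_imp[OF p, of "z * u"] theta_eq_0_imp[OF p, of "z / u"] z nz by auto
      then have "u\<^sup>2 = p powi (k - l)"
        using nz z by (simp add: power_int_diff power2_eq_square flip: \<open>z * u = _\<close> \<open>z / u = _\<close>)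
      then show False using u2 by blast
    qed
    consider "theta p (z * u) = 0" | "theta p (z / u) = 0"
      using zero by (auto simp: h_def)
    then show "F z = 0 \<and> deriv (h u) z \<noteq> 0"
    proof cases
      case 1
      then obtain k where "z * u = p powi k"
        using theta_eq_0_imp[OF p, of "z * u"] z nz by auto
      then have "z = p powi k * (1 / u)"
        using nz by (simp add: field_simps)
      then have "F z = 0"
        using F_powi[OF _ \<open>F (1 / u) = 0\<close>, of k] nz by simp
      moreover have "D1 \<noteq> 0"
        using theta_deriv_nonzero[OF p nz(1) 1 _ D(1)] nz z by simp
      ultimately show ?thesis
        using 1 not_both nz by (simp add: deriv)
    next
      case 2
      then obtain k where "z / u = p powi k"
        using theta_eq_0_imp[OF p, of "z / u"] z nz by auto
      then have "z = p powi k * u"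
        using nz by (simp add: field_simps)
      then have "F z = 0"
        using F_powi[OF _ \<open>F u = 0\<close>, of k] nz by simp
      moreover have "D2 \<noteq> 0"
        using theta_deriv_nonzero[OF p nz(1) 2 _ D(2)] nz z by simp
      ultimately show ?thesis
        using 2 not_both nz by (simp add: deriv)
    qed
  qed (use p nz h_hol F_per h_per in auto)
  then obtain C where C: "\<And>z. z \<noteq> 0 \<Longrightarrow> F z = C * h u z" by metis
  have hvv: "h v v = 0" by (simp add: h_def p nz)
  have swap: "h u v = - (v / u) * h v u" "h y v = - (v / y) * h v y"
    using theta_product_swap[of u v] theta_product_swap[of y v] nz by (simp_all add: h_def)
  have "h v u \<noteq> 0"
    using gen by (simp add: h_def)
  moreover have "F v = h y v * h v u" by (simp add: F_def hvv)
  ultimately have "C = u / y * h v y"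
    using C[of v] nz swap by (simp add: field_simps)
  then show ?thesis
    using C[of x] nz by (simp add: F_def h_def)
qed

text \<open>Both sides are continuous in \<open>u\<close>, and the excluded \<open>u\<close> form a
  countable set; both square roots are listed in \<open>S\<close> because one condition is on
  u^2.\<close>

lemma theta_three_term:
  assumes nz: "x \<noteq> 0" "y \<noteq> 0" "u \<noteq> 0" "v \<noteq> 0"
  shows "theta p (x * y) * theta p (x / y) * (theta p (u * v) * theta p (u / v))
    - theta p (x * v) * theta p (x / v) * (theta p (u * y) * theta p (u / y))
    = u / y * (theta p (y * v) * theta p (y / v)) * (theta p (x * u) * theta p (x / u))"
proof (cases "p = 0")
  case True
  show ?thesis
    unfolding True theta_p_zero using nz by (simp add: field_simps)
next
  case False
  define S where "S = insert 0 ((\<lambda>z. csqrt z) ` {z. theta p z = 0} \<union> (\<lambda>z. - csqrt z) ` {z. theta p z = 0}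
    \<union> (\<lambda>z. z / v) ` {z. theta p z = 0} \<union> (\<lambda>z. z * v) ` {z. theta p z = 0})"
  show ?thesis
  proof (rule continuous_eq_off_countable[where S = S and w = u])
    show "countable S"
      unfolding S_def using countable_theta_zeros[OF p] by auto
    fix u assume u: "u \<notin> S"
    then have "u \<noteq> 0" by (auto simp: S_def)
    moreover have "theta p (u\<^sup>2) \<noteq> 0"
    proof
      assume 0: "theta p (u\<^sup>2) = 0"
      have "u = csqrt (u\<^sup>2) \<or> u = - csqrt (u\<^sup>2)"
        by (metis power2_csqrt power2_eq_iff)
      then show False using u 0 unfolding S_def by blast
    qed
    moreover have "theta p (u * v) \<noteq> 0"
    proof
      assume 0: "theta p (u * v) = 0"
      have "u = (u * v) / v" using nz by simp
      then show False using u 0 unfolding S_def by blast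
    qed
    moreover have "theta p (u / v) \<noteq> 0"
    proof
      assume 0: "theta p (u / v) = 0"
      have "u = (u / v) * v" using nz by simp
      then show False using u 0 unfolding S_def by blast
    qed
    ultimately show "theta p (x * y) * theta p (x / y) * (theta p (u * v) * theta p (u / v))
      - theta p (x * v) * theta p (x / v) * (theta p (u * y) * theta p (u / y))
      = u / y * (theta p (y * v) * theta p (y / v)) * (theta p (x * u) * theta p (x / u))"
      using theta_three_term_generic False nz by blast
  qed (use nz in \<open>auto intro!: continuous_intros isCont_theta[OF p]\<close>)
qed

end

section \<open>Interpolation by theta functions\<close>

text \<open>With k a square root of q, X = s k and Y = b / k, this is theta(X Y) theta(X / Y), the
  shape met in the three-term relation. \<open>pair p q (1 / \<beta>)\<close> is the one that
  vanishes at b = \<beta>.\<close>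

definition pair :: "complex \<Rightarrow> complex \<Rightarrow> complex \<Rightarrow> complex \<Rightarrow> complex" where
  "pair p q s b = theta p (s * b) * theta p (s * q / b)"

text \<open>A binary form of degree N in (X, Y), stored as a polynomial in one variable so that
  roots can be counted. Unlike \<open>poly P (X / Y)\<close> it also makes sense at Y = 0.\<close>

definition hom_eval :: "nat \<Rightarrow> complex poly \<Rightarrow> complex \<Rightarrow> complex \<Rightarrow> complex" where
  "hom_eval N P X Y = (\<Sum>i\<le>N. coeff P i * X ^ i * Y ^ (N - i))"

lemma hom_eval_eq_poly:
  assumes "degree P \<le> N" "Y \<noteq> 0"
  shows "hom_eval N P X Y = Y ^ N * poly P (X / Y)"
proof -
  have "poly P (X / Y) = (\<Sum>i\<le>N. coeff P i * (X / Y) ^ i)"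
    unfolding poly_altdef using assms(1)
    by (intro sum.mono_neutral_left) (auto simp: coeff_eq_0)
  then show ?thesis
    unfolding hom_eval_def using assms(2)
    by (auto simp: sum_distrib_left power_diff field_simps intro!: sum.cong)
qed

lemma hom_eval_mult_linear:
  assumes "degree P \<le> N"
  shows "hom_eval (Suc N) (P * [:\<beta>, \<alpha>:]) X Y = hom_eval N P X Y * (\<alpha> * X + \<beta> * Y)"
proof -
  have eq: "P * [:\<beta>, \<alpha>:] = smult \<beta> P + pCons 0 (smult \<alpha> P)"
    by (simp add: mult.commute)
  have "hom_eval (Suc N) (smult \<beta> P) X Y = hom_eval N P X Y * (\<beta> * Y)"
    using assms by (auto simp: hom_eval_def sum_distrib_right sum_distrib_left Suc_diff_le
        coeff_eq_0 mult_ac intro!: sum.cong)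
  moreover have "hom_eval (Suc N) (pCons 0 (smult \<alpha> P)) X Y = hom_eval N P X Y * (\<alpha> * X)"
    unfolding hom_eval_def by (subst sum.atMost_Suc_shift) 
      (simp add: sum_distrib_right sum_distrib_left mult_ac)
  moreover have "hom_eval (Suc N) (Q + R) X Y = hom_eval (Suc N) Q X Y + hom_eval (Suc N) R X Y" for Q R
    by (simp add: hom_eval_def sum.distrib algebra_simps)
  ultimately show ?thesis
    unfolding eq by (simp add: algebra_simps)
qed

section \<open>Sums of products of N pairs as binary forms of degree N\<close>

context
  fixes p q :: complex
  assumes p: "norm p < 1" and q: "q \<noteq> 0"
begin

text \<open>To be read in \<open>b\<close>: whenever \<open>pair p q (1 / u) v\<close> is nonzero,
  \<open>pair p q s\<close> is a linear combination of \<open>pair p q (1 / u)\<close> and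
  \<open>pair p q (1 / v)\<close> with coefficients independent of \<open>b\<close>.\<close>

lemma pair_three_term:
  assumes nz: "s \<noteq> 0" "b \<noteq> 0" "u \<noteq> 0" "v \<noteq> 0"
  shows "pair p q s b * pair p q (1 / u) v
    = pair p q s v * pair p q (1 / u) b - v / u * pair p q s u * pair p q (1 / v) b"
proof -
  define k where "k = csqrt q"
  have k: "k \<noteq> 0" "q = k * k"
    using q by (simp_all add: k_def flip: power2_eq_square)
  have swap: "theta p (b * v / q) = - (b * v / q) * theta p (q / (b * v))"
    using theta_swap[OF p, of "b * v" q] nz q by simp
  have "theta p (s * b) * theta p (s * q / b) * (theta p (v / u) * theta p (q / (u * v)))
      - theta p (s * v) * theta p (s * q / v) * (theta p (b / u) * theta p (q / (u * b)))
      = q / (u * b) * (theta p (b * v / q) * theta p (b / v)) * (theta p (s * q / u) * theta p (s * u))"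
    using theta_three_term[OF p, of "s * k" "b / k" "k / u" "v / k"] nz k
    by (simp add: mult_ac)
  then show ?thesis
    unfolding swap pair_def using nz q by (simp add: field_simps)
qed

text \<open>Linear combinations of products of N pairs. The inductive form records the degree and
  lets properties be proved along the construction, without a normal form for the sum.\<close>

inductive theta_form :: "nat \<Rightarrow> (complex \<Rightarrow> complex) \<Rightarrow> bool" where
  const: "theta_form 0 (\<lambda>_. c)"
| mult: "theta_form N f \<Longrightarrow> s \<noteq> 0 \<Longrightarrow> theta_form (Suc N) (\<lambda>b. f b * pair p q s b)"
| add: "theta_form N f \<Longrightarrow> theta_form N g \<Longrightarrow> theta_form N (\<lambda>b. f b + g b)"

lemma theta_form_scale: "theta_form N f \<Longrightarrow> theta_form N (\<lambda>b. z * f b)"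
proof (induction rule: theta_form.induct)
  case (const c)
  show ?case by (rule theta_form.const)
next
  case (mult N f s)
  then show ?case
    using theta_form.mult[of N "\<lambda>b. z * f b" s] by (simp add: mult.assoc)
next
  case (add N f g)
  then show ?case
    using theta_form.add[of N "\<lambda>b. z * f b" "\<lambda>b. z * g b"] by (simp add: distrib_left)
qed

lemma theta_form_sum:
  assumes "finite A" "A \<noteq> {}" "\<And>k. k \<in> A \<Longrightarrow> theta_form N (f k)"
  shows "theta_form N (\<lambda>b. \<Sum>k\<in>A. f k b)"
  using assms
proof (induction rule: finite_ne_induct)
  case (insert k A)
  then have "theta_form N (\<lambda>b. f k b + (\<Sum>k\<in>A. f k b))"
    by (intro theta_form.add) simp_all
  then show ?case using insert by simp
qed simp

lemma theta_form_hom_eval: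
  assumes "theta_form N f" and "\<beta>0 \<noteq> 0" "\<beta>1 \<noteq> 0" "pair p q (1 / \<beta>0) \<beta>1 \<noteq> 0"
  shows "\<exists>P. degree P \<le> N \<and>
    (\<forall>b. b \<noteq> 0 \<longrightarrow> f b = hom_eval N P (pair p q (1 / \<beta>1) b) (pair p q (1 / \<beta>0) b))"
  using assms(1)
proof induction
  case (const c)
  then show ?case
    by (intro exI[of _ "[:c:]"]) (simp add: hom_eval_def)
next
  case (mult N f s)
  then obtain P where P: "degree P \<le> N"
    "\<And>b. b \<noteq> 0 \<Longrightarrow> f b = hom_eval N P (pair p q (1 / \<beta>1) b) (pair p q (1 / \<beta>0) b)" by blast
  \<comment> \<open>\<alpha> and \<beta> are obtained by solving \<open>pair_three_term\<close> with
    u = \<open>\<beta>0\<close> and v = \<open>\<beta>1\<close> for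
    \<open>pair p q s b\<close>.\<close>
  define \<alpha> where "\<alpha> = - \<beta>1 / \<beta>0 * pair p q s \<beta>0 / pair p q (1 / \<beta>0) \<beta>1"
  define \<beta> where "\<beta> = pair p q s \<beta>1 / pair p q (1 / \<beta>0) \<beta>1"
  have lin: "pair p q s b = \<alpha> * pair p q (1 / \<beta>1) b + \<beta> * pair p q (1 / \<beta>0) b" if "b \<noteq> 0" for b
    using pair_three_term[OF mult(2) that assms(2,3)] assms(4)
    by (simp add: \<alpha>_def \<beta>_def field_simps)
  have "degree (P * [:\<beta>, \<alpha>:]) \<le> Suc N"
    using degree_mult_le[of P "[:\<beta>, \<alpha>:]"] P(1) by (auto split: if_splits)
  then show ?case
    using P lin by (intro exI[of _ "P * [:\<beta>, \<alpha>:]"]) (simp add: hom_eval_mult_linear del: mult_pCons_right)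
next
  case (add N f g)
  then obtain P Q where "degree P \<le> N" "degree Q \<le> N"
    "\<And>b. b \<noteq> 0 \<Longrightarrow> f b = hom_eval N P (pair p q (1 / \<beta>1) b) (pair p q (1 / \<beta>0) b)"
    "\<And>b. b \<noteq> 0 \<Longrightarrow> g b = hom_eval N Q (pair p q (1 / \<beta>1) b) (pair p q (1 / \<beta>0) b)" by blast
  then show ?case
    by (intro exI[of _ "P + Q"]) (simp add: degree_add_le hom_eval_def sum.distrib algebra_simps)
qed

lemma theta_form_0: "theta_form N f \<Longrightarrow> N = 0 \<Longrightarrow> \<exists>c. f = (\<lambda>_. c)"
  by (induction rule: theta_form.induct) auto

text \<open>A binary form of degree N with N + 1 distinct zeros on the projective line is zero. The
  coordinates X and Y are chosen to vanish at two of the given points.\<close>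

lemma theta_form_eq_0:
  assumes form: "theta_form N f" and card: "card J = Suc N"
    and nz: "\<And>j. j \<in> J \<Longrightarrow> \<beta> j \<noteq> 0"
    and indep: "\<And>i j. i \<in> J \<Longrightarrow> j \<in> J \<Longrightarrow> i \<noteq> j \<Longrightarrow> pair p q (1 / \<beta> i) (\<beta> j) \<noteq> 0"
    and zero: "\<And>j. j \<in> J \<Longrightarrow> f (\<beta> j) = 0"
    and b: "b \<noteq> 0"
  shows "f b = 0"
proof (cases N)
  case 0
  then obtain c where "f = (\<lambda>_. c)" using theta_form_0 form by blast
  moreover have "J \<noteq> {}" using card by auto
  ultimately show ?thesis using zero by auto
next
  case (Suc M)
  have "finite J" using card card.infinite by fastforce
  obtain j0 where j0: "j0 \<in> J" using card by fastforce
  have card': "card (J - {j0}) = Suc M"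
    using card j0 Suc by simp
  then have "J - {j0} \<noteq> {}" by (metis card.empty nat.distinct(1))
  then obtain j1 where j1: "j1 \<in> J" "j1 \<noteq> j0" by blast
  define X where "X = pair p q (1 / \<beta> j1)"
  define Y where "Y = pair p q (1 / \<beta> j0)"
  obtain P where P: "degree P \<le> N" "\<And>b. b \<noteq> 0 \<Longrightarrow> f b = hom_eval N P (X b) (Y b)"
    unfolding X_def Y_def
    using theta_form_hom_eval[OF form nz[OF j0] nz[OF j1(1)] indep[OF j0 j1(1)]] j1 by metis
  have Y0: "Y (\<beta> j0) = 0" using nz[OF j0] by (simp add: Y_def pair_def p)
  \<comment> \<open>The point \<open>\<beta> j0\<close> lies at infinity (Y = 0), where only the
    coefficient of X^N is left. Its vanishing lowers the degree by one, and the other N points are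
    finite.\<close>
  have "coeff P N * X (\<beta> j0) ^ N = hom_eval N P (X (\<beta> j0)) (Y (\<beta> j0))"
    unfolding hom_eval_def Y0 using Suc
    by (simp add: power_0_left Suc_diff_le)
  also have "\<dots> = 0" using P(2) zero nz j0 by metis
  finally have "coeff P N = 0" using indep[OF j1(1) j0 j1(2)] by (simp add: X_def)
  have "P = 0"
  proof (rule ccontr)
    assume "P \<noteq> 0"
    then have "degree P \<noteq> N" using \<open>coeff P N = 0\<close> by auto
    then have deg: "degree P \<le> M" using P(1) Suc by simp
    have Y: "Y (\<beta> j) \<noteq> 0" if "j \<in> J - {j0}" for j
      using that indep[OF j0, of j] by (auto simp: Y_def)
    \<comment> \<open>The ratios differ again by the three-term relation: with s = 1 /
      \<open>\<beta> j1\<close>, u = \<open>\<beta> j0\<close> and v = \<open>\<beta> j\<close> it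
      writes the determinant of the two points as a product of nonzero factors.\<close>
    have "inj_on (\<lambda>j. X (\<beta> j) / Y (\<beta> j)) (J - {j0})"
    proof (rule inj_onI, rule ccontr)
      fix i j assume ij: "i \<in> J - {j0}" "j \<in> J - {j0}" "i \<noteq> j"
        and "X (\<beta> i) / Y (\<beta> i) = X (\<beta> j) / Y (\<beta> j)"
      then have "X (\<beta> i) * Y (\<beta> j) = X (\<beta> j) * Y (\<beta> i)"
        using Y by (simp add: field_simps)
      then have "\<beta> j / \<beta> j0 * X (\<beta> j0) * pair p q (1 / \<beta> j) (\<beta> i) = 0"
        using pair_three_term[of "1 / \<beta> j1" "\<beta> i" "\<beta> j0" "\<beta> j"] ij nz j0 j1
        unfolding X_def Y_def by simp
      then show False
        using ij nz j0 j1 indep by (simp add: X_def)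
    qed
    then have "Suc M = card ((\<lambda>j. X (\<beta> j) / Y (\<beta> j)) ` (J - {j0}))"
      using card' by (simp add: card_image)
    also have "\<dots> \<le> card {z. poly P z = 0}"
    proof (intro card_mono poly_roots_finite \<open>P \<noteq> 0\<close> image_subsetI CollectI)
      fix j assume j: "j \<in> J - {j0}"
      then show "poly P (X (\<beta> j) / Y (\<beta> j)) = 0"
        using hom_eval_eq_poly[OF P(1) Y[OF j], of "X (\<beta> j)"] P(2)[OF nz] zero[of j] Y[OF j] by auto
    qed
    also have "\<dots> \<le> M"
      using card_poly_roots_bound[OF \<open>P \<noteq> 0\<close>] deg by linarith
    finally show False by simp
  qed
  then show ?thesis using P(2)[OF b] by (simp add: hom_eval_def)
qed

end

section \<open>Elliptic shifted factorials\<close>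

lemma efac_0 [simp]: "efac q p z 0 = 1"
  by (simp add: efac_def)

lemma efac_Suc: "efac q p z (Suc k) = efac q p z k * theta p (z * q ^ k)"
  by (simp add: efac_def)

lemma efac_1: "efac q p z (Suc 0) = theta p z"
  by (simp add: efac_def)

lemma efac_add: "efac q p z (m + k) = efac q p z m * efac q p (z * q ^ m) k"
  by (induction k) (simp_all add: efac_Suc power_add mult_ac)

lemma efac_Suc_shift: "efac q p z (Suc k) = theta p z * efac q p (z * q) k"
  using efac_add[of q p z 1 k] by (simp add: efac_1)

lemma efac_split_last:
  "efac q p z (k + 1 + m) = efac q p z k * theta p (z * q ^ k) * efac q p (z * q ^ (k + 1)) m"
  using efac_add[of q p z "Suc k" m] by (simp add: efac_Suc)

lemma efac_split_first:
  "efac q p z (k + 1 + m) = theta p z * efac q p (z * q) k * efac q p (z * q ^ (k + 1)) m"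
  using efac_add[of q p z "Suc k" m] by (simp add: efac_Suc_shift)

lemma efac_eq_0_iff: "efac q p z k = 0 \<longleftrightarrow> (\<exists>j<k. theta p (z * q ^ j) = 0)"
  by (auto simp: efac_def)

lemma efac_double: "efac (q\<^sup>2) p z k * efac (q\<^sup>2) p (z * q) k = efac q p z (2 * k)"
  by (induction k) (simp_all add: efac_Suc mult_ac power_mult[symmetric])

text \<open>\<open>tri q m\<close> is $q^{m(m-1)/2}$ without division of exponents.\<close>

definition tri :: "complex \<Rightarrow> nat \<Rightarrow> complex" where
  "tri q m = (\<Prod>j<m. q ^ j)"

lemma tri_square: "(tri q m)\<^sup>2 * q ^ m = q ^ (m * m)"
  by (induction m) (simp_all add: tri_def power_mult_distrib power2_eq_square power_add mult_ac)

lemma tri_base_square: "tri (q\<^sup>2) m = (tri q m)\<^sup>2"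
  by (simp add: tri_def prod_power_distrib power_mult[symmetric] mult.commute)

lemma tri_nonzero: "q \<noteq> 0 \<Longrightarrow> tri q m \<noteq> 0"
  by (simp add: tri_def)

section \<open>Reversal and regrouping of shifted factorials\<close>

context
  fixes p :: complex
  assumes p: "norm p < 1"
begin

text \<open>In every factor theta(y) = - y theta(1 / y), and the product is then read from the last
  factor to the first; the prefactors multiply to (-z)^m q^(m(m-1)/2).\<close>

lemma efac_reverse:
  assumes "q \<noteq> 0" "z \<noteq> 0"
  shows "efac q p z m = (- z) ^ m * tri q m * efac q p (q / (z * q ^ m)) m"
proof -
  have "efac q p z m = (\<Prod>j<m. - z * q ^ j * theta p (1 / (z * q ^ j)))"
    unfolding efac_def using assms by (intro prod.cong) (simp_all add: theta_inverse[OF p])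
  also have "\<dots> = (- z) ^ m * tri q m * (\<Prod>j<m. theta p (1 / (z * q ^ j)))"
    unfolding prod.distrib tri_def by simp
  also have "(\<Prod>j<m. theta p (1 / (z * q ^ j))) = (\<Prod>j<m. theta p (1 / (z * q ^ (m - Suc j))))"
    by (rule prod.nat_diff_reindex[symmetric])
  also have "\<dots> = efac q p (q / (z * q ^ m)) m"
    unfolding efac_def
  proof (intro prod.cong refl arg_cong[of _ _ "theta p"])
    fix j assume "j \<in> {..<m}"
    then have "q ^ m = q ^ (m - Suc j) * q ^ j * q"
      by (simp flip: power_add power_Suc2)
    then show "1 / (z * q ^ (m - Suc j)) = q / (z * q ^ m) * q ^ j"
      using assms by (simp add: field_simps)
  qed
  finally show ?thesis .
qed

text \<open>Reversing \<open>efac q p (y / q ^ n) m\<close> gives the tail of the run of length n +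
  m that starts at q / (q^m y), and this run can be cut after n or after m factors. It serves later
  in base q^2 with y = x_i0 / x_j, j \<noteq> i0.\<close>

lemma efac_shift_ratio:
  assumes "q \<noteq> 0" "y \<noteq> 0"
  shows "theta p (q ^ m * y) * efac q p (y / q ^ n) m * efac q p (q / (q ^ m * y)) n * q ^ (n * m)
    = theta p y * efac q p (q * y) m * efac q p (q / y) n"
proof -
  have 1: "efac q p y m * theta p (q ^ m * y) = theta p y * efac q p (q * y) m"
    using efac_Suc[of q p y m] efac_add[of q p y 1 m] by (simp add: efac_1 mult_ac)
  have 2: "efac q p y m = (- y) ^ m * tri q m * efac q p (q / (q ^ m * y)) m"
    using efac_reverse[of q y m] assms by (simp add: mult_ac)
  have 3: "efac q p (y / q ^ n) m * q ^ (n * m) = (- y) ^ m * tri q m * efac q p (q / (q ^ m * y) * q ^ n) m"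
  proof -
    have "(- (y / q ^ n)) ^ m * q ^ (n * m) = (- y) ^ m"
      using assms by (simp add: power_mult flip: power_mult_distrib)
    moreover have "q / (y / q ^ n * q ^ m) = q / (q ^ m * y) * q ^ n"
      using assms by (simp add: field_simps)
    ultimately show ?thesis
      using efac_reverse[of q "y / q ^ n" m] assms by (simp only: mult_ac) (simp flip: mult.assoc)
  qed
  have 4: "efac q p (q / (q ^ m * y)) n * efac q p (q / (q ^ m * y) * q ^ n) m
      = efac q p (q / (q ^ m * y)) m * efac q p (q / y) n"
    using efac_add[of q p "q / (q ^ m * y)" n m] efac_add[of q p "q / (q ^ m * y)" m n] assms
    by (simp add: add.commute)
  have "theta p (q ^ m * y) * efac q p (y / q ^ n) m * efac q p (q / (q ^ m * y)) n * q ^ (n * m)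
    = theta p (q ^ m * y) * (efac q p (y / q ^ n) m * q ^ (n * m)) * efac q p (q / (q ^ m * y)) n"
    by (simp only: mult_ac)
  also have "\<dots> = theta p (q ^ m * y) * ((- y) ^ m * tri q m) *
      (efac q p (q / (q ^ m * y)) n * efac q p (q / (q ^ m * y) * q ^ n) m)"
    unfolding 3 by (simp only: mult_ac)
  also have "\<dots> = (efac q p y m * theta p (q ^ m * y)) * efac q p (q / y) n"
    unfolding 4 2 by (simp only: mult_ac)
  finally show ?thesis unfolding 1 .
qed

text \<open>The counterpart for j = i0: at y = 1 the previous identity reads 0 = 0, and with the
  vanishing factor taken out the run of length n keeps only its last n - m factors.\<close>

lemma efac_shift_ratio_diagonal:
  assumes "q \<noteq> 0" "m \<le> n"
  shows "efac q p (1 / q ^ n) m * efac q p q (n - m) * q ^ (n * m)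
    = (- 1) ^ m * tri q m * (efac q p q m * efac q p (q * q ^ m) (n - m))"
proof -
  have 1: "efac q p (1 / q ^ n) m * q ^ (n * m) = (- 1) ^ m * tri q m * efac q p (q * q ^ (n - m)) m"
  proof -
    have "(- (1 / q ^ n)) ^ m * q ^ (n * m) = (- 1) ^ m"
      using assms by (simp add: power_mult flip: power_mult_distrib)
    moreover have "q / (1 / q ^ n * q ^ m) = q * q ^ (n - m)"
      using assms by (simp add: field_simps power_diff)
    ultimately show ?thesis
      using efac_reverse[of q "1 / q ^ n" m] assms by (simp only: mult_ac) (simp flip: mult.assoc)
  qed
  have 2: "efac q p q (n - m) * efac q p (q * q ^ (n - m)) m = efac q p q m * efac q p (q * q ^ m) (n - m)"
    using efac_add[of q p q "n - m" m] efac_add[of q p q m "n - m"] assms by simp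
  have "efac q p (1 / q ^ n) m * efac q p q (n - m) * q ^ (n * m)
    = (efac q p (1 / q ^ n) m * q ^ (n * m)) * efac q p q (n - m)"
    by (simp only: mult_ac)
  also have "\<dots> = (- 1) ^ m * tri q m * (efac q p q (n - m) * efac q p (q * q ^ (n - m)) m)"
    unfolding 1 by (simp only: mult_ac)
  finally show ?thesis unfolding 2 .
qed

text \<open>Both sides are \<open>efac q p z (m + 1 + l)\<close>, with the single theta factor taken
  out after m factors on the left and in front on the right.\<close>

lemma efac_insert_shift:
  "theta p (z * q ^ m) * efac q p z m * efac q p (z * q ^ (m + 1)) l
    = theta p z * efac q p (z * q) l * efac q p (z * q ^ (l + 1)) m"
  using efac_split_last[of q p z m l] efac_split_first[of q p z l m] by (simp add: add_ac mult_ac)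

text \<open>For the index i0, with z = a x_i0. The runs of length m from z, from z q^m (this is
  \<open>efac q p (q / b) m\<close> reversed) and from b = z q^(2m), the factor at z q^(3m) and the
  long run after it are adjacent. They form one run of length 2n + 1 + m, cut differently on the
  right.\<close>

lemma efac_triple_shift:
  assumes "q \<noteq> 0" "z \<noteq> 0" "m \<le> n" "b = z * q ^ (2 * m)"
  shows "theta p (z * q ^ (3 * m)) * efac q p z m * efac q p (z * q ^ (3 * m + 1)) (2 * (n - m))
      * (efac q p b m * efac q p (q / b) m)
    = theta p z * efac q p (z * q ^ (2 * n + 1)) m * efac q p (z * q) (2 * n) * ((- q / b) ^ m * tri q m)"
proof -
  have b: "b \<noteq> 0" using assms by simp
  have 1: "efac q p (q / b) m = (- q / b) ^ m * tri q m * efac q p (z * q ^ m) m"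
  proof -
    have "q / (q / b * q ^ m) = z * q ^ m"
      using assms by (simp add: mult_2 power_add)
    then show ?thesis
      using efac_reverse[of q "q / b" m] assms(1) b by simp
  qed
  have 2: "efac q p z (3 * m + 1 + 2 * (n - m)) = efac q p z m * efac q p (z * q ^ m) m * efac q p b m
      * theta p (z * q ^ (3 * m)) * efac q p (z * q ^ (3 * m + 1)) (2 * (n - m))"
  proof -
    have "efac q p z (3 * m) = efac q p z (m + m + m)"
      by (rule arg_cong[of _ _ "efac q p z"]) simp
    also have "\<dots> = efac q p z m * efac q p (z * q ^ m) m * efac q p b m"
      by (simp only: efac_add[of _ _ _ "m + m"] efac_add[of _ _ z m] assms mult_2)
    finally show ?thesis
      by (simp only: efac_split_last)
  qed
  have 3: "3 * m + 1 + 2 * (n - m) = 2 * n + 1 + m" using assms(3) by simp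
  have "theta p (z * q ^ (3 * m)) * efac q p z m * efac q p (z * q ^ (3 * m + 1)) (2 * (n - m))
      * (efac q p b m * efac q p (q / b) m)
    = efac q p z m * efac q p (z * q ^ m) m * efac q p b m
      * theta p (z * q ^ (3 * m)) * efac q p (z * q ^ (3 * m + 1)) (2 * (n - m)) * ((- q / b) ^ m * tri q m)"
    unfolding 1 by (simp only: mult_ac)
  also have "\<dots> = efac q p z (2 * n + 1 + m) * ((- q / b) ^ m * tri q m)"
    unfolding 2[symmetric] 3 ..
  finally show ?thesis
    unfolding efac_split_first by (simp only: mult_ac)
qed

text \<open>Balancing does two things here: the run from d z continues the run of length N - m from
  a^2 z q^(2m+1) / c, and the reversed run from a q / d becomes the tail of the run of length 2N
  from a q / c.\<close>

lemma efac_balanced_shift: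
  assumes nz: "q \<noteq> 0" "a \<noteq> 0" "c \<noteq> 0" "d \<noteq> 0" "z \<noteq> 0" and m: "m \<le> N"
    and bal: "a\<^sup>2 * q ^ (2 * N + 1) = c * d"
  shows "efac (q\<^sup>2) p (c * z) m * efac (q\<^sup>2) p (d * z) m
      * (efac (q\<^sup>2) p (q\<^sup>2 / (c * z)) (N - m) * efac (q\<^sup>2) p (a\<^sup>2 * z * q ^ (2 * m + 1) / c) (N - m))
      * efac q p (a * q / c) (2 * N) * ((- c / a) ^ m * tri q m)
    = efac (q\<^sup>2) p (q\<^sup>2 / (c * z * q ^ (2 * m))) N * efac (q\<^sup>2) p (a\<^sup>2 * z * q ^ (2 * m + 1) / c) N
      * ((- (c * z)) ^ m * (tri q m)\<^sup>2)
      * (efac q p (a * q / c) m * efac q p (a * q / d) m) * efac q p (a * q ^ m * q / c) (2 * (N - m))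
      * q ^ (2 * N * m)"
proof -
  have d: "d = a\<^sup>2 * q ^ (2 * N + 1) / c" using bal nz by (simp add: field_simps)
  have 1: "efac (q\<^sup>2) p (c * z) m * efac (q\<^sup>2) p (q\<^sup>2 / (c * z)) (N - m)
      = (- (c * z)) ^ m * (tri q m)\<^sup>2 * efac (q\<^sup>2) p (q\<^sup>2 / (c * z * q ^ (2 * m))) N"
  proof -
    have "efac (q\<^sup>2) p (q\<^sup>2 / (c * z * q ^ (2 * m))) (m + (N - m))
      = efac (q\<^sup>2) p (q\<^sup>2 / (c * z * q ^ (2 * m))) m * efac (q\<^sup>2) p (q\<^sup>2 / (c * z)) (N - m)"
      unfolding efac_add using nz by (simp add: power_mult)
    then show ?thesis
      using efac_reverse[of "q\<^sup>2" "c * z" m] nz m by (simp add: power_mult tri_base_square)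
  qed
  have 2: "efac (q\<^sup>2) p (a\<^sup>2 * z * q ^ (2 * m + 1) / c) (N - m) * efac (q\<^sup>2) p (d * z) m
      = efac (q\<^sup>2) p (a\<^sup>2 * z * q ^ (2 * m + 1) / c) N"
  proof -
    have "q ^ (2 * m + 1) * (q\<^sup>2) ^ (N - m) = q ^ (2 * N + 1)"
    proof -
      have "2 * N + 1 = 2 * m + 1 + 2 * (N - m)" using m by simp
      then show ?thesis by (simp only: power_add power_mult)
    qed
    from this[symmetric] have "a\<^sup>2 * z * q ^ (2 * m + 1) / c * (q\<^sup>2) ^ (N - m) = d * z"
      unfolding d by (simp only: times_divide_eq_left times_divide_eq_right mult_ac)
    then show ?thesis
      using efac_add[of "q\<^sup>2" p "a\<^sup>2 * z * q ^ (2 * m + 1) / c" "N - m" m] m by simp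
  qed
  have 3: "efac q p (a * q / d) m * q ^ (2 * N * m)
      = (- c / a) ^ m * tri q m * efac q p (a * q / c * q ^ (m + 2 * (N - m))) m"
  proof -
    have w: "a * q / d = c / (a * q ^ (2 * N))"
      unfolding d using nz by (simp add: field_simps power2_eq_square)
    have "q ^ (m + 2 * (N - m)) * q ^ m = q ^ (2 * N)"
    proof -
      have "2 * N = m + 2 * (N - m) + m" using m by simp
      then show ?thesis by (simp only: power_add)
    qed
    then have "q / (c / (a * q ^ (2 * N)) * q ^ m) = a * q / c * q ^ (m + 2 * (N - m))"
      using nz by (simp add: field_simps)
    moreover have "(- (c / (a * q ^ (2 * N)))) ^ m * q ^ (2 * N * m) = (- c / a) ^ m"
      using nz by (simp add: power_mult flip: power_mult_distrib)
    ultimately show ?thesis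
      unfolding w using efac_reverse[of q "c / (a * q ^ (2 * N))" m] nz by (simp add: mult_ac)
  qed
  have 4: "efac q p (a * q / c) m * efac q p (a * q ^ m * q / c) (2 * (N - m))
      * efac q p (a * q / c * q ^ (m + 2 * (N - m))) m = efac q p (a * q / c) (2 * N)"
  proof -
    have "2 * N = m + 2 * (N - m) + m" using m by simp
    then show ?thesis
      using efac_add[of q p "a * q / c" "m + 2 * (N - m)" m] efac_add[of q p "a * q / c" m "2 * (N - m)"]
      by (simp add: mult_ac)
  qed
  have "efac (q\<^sup>2) p (q\<^sup>2 / (c * z * q ^ (2 * m))) N * efac (q\<^sup>2) p (a\<^sup>2 * z * q ^ (2 * m + 1) / c) N
      * ((- (c * z)) ^ m * (tri q m)\<^sup>2)
      * (efac q p (a * q / c) m * efac q p (a * q / d) m) * efac q p (a * q ^ m * q / c) (2 * (N - m))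
      * q ^ (2 * N * m)
    = ((- (c * z)) ^ m * (tri q m)\<^sup>2 * efac (q\<^sup>2) p (q\<^sup>2 / (c * z * q ^ (2 * m))) N)
      * efac (q\<^sup>2) p (a\<^sup>2 * z * q ^ (2 * m + 1) / c) N
      * (efac q p (a * q / d) m * q ^ (2 * N * m))
      * (efac q p (a * q / c) m * efac q p (a * q ^ m * q / c) (2 * (N - m)))"
    by (simp only: mult_ac)
  also have "\<dots> = (efac (q\<^sup>2) p (c * z) m * efac (q\<^sup>2) p (q\<^sup>2 / (c * z)) (N - m))
      * (efac (q\<^sup>2) p (a\<^sup>2 * z * q ^ (2 * m + 1) / c) (N - m) * efac (q\<^sup>2) p (d * z) m)
      * ((- c / a) ^ m * tri q m) * (efac q p (a * q / c) m * efac q p (a * q ^ m * q / c) (2 * (N - m))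
      * efac q p (a * q / c * q ^ (m + 2 * (N - m))) m)"
    unfolding 1 2 3 by (simp only: mult_ac)
  finally show ?thesis unfolding 4 by (simp only: mult_ac)
qed

end

section \<open>The terms of the sum under a shift\<close>

lemma efacs_pair: "efacs q p [u, v] k = efac q p u k * efac q p v k"
  by (simp add: efacs_def)

lemma power_int_neg_double: "q powi (- 2 * int n) = 1 / (q :: complex) ^ (2 * n)"
proof -
  have "- 2 * int n = - int (2 * n)" by simp
  then show ?thesis
    by (simp only: power_int_minus power_int_of_nat inverse_eq_divide)
qed

definition bump :: "nat \<Rightarrow> nat \<Rightarrow> nat \<Rightarrow> nat" where
  "bump i0 m = (\<lambda>i. if i = i0 then m else 0)"

lemma weight_add: "weight r (\<lambda>i. k i + l i) = weight r k + weight r l"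
  by (simp add: weight_def sum.distrib)

lemma weight_bump: "i0 \<in> {1..r} \<Longrightarrow> weight r (bump i0 m) = m"
  by (simp add: weight_def bump_def)

lemma weight_diff_bump:
  assumes "i0 \<in> {1..r}" "m \<le> n i0"
  shows "weight r n = weight r (\<lambda>i. n i - bump i0 m i) + m"
proof -
  have "n i = (n i - bump i0 m i) + bump i0 m i" for i
    using assms by (simp add: bump_def)
  then have "weight r n = weight r (\<lambda>i. (n i - bump i0 m i) + bump i0 m i)"
    by simp
  then show ?thesis
    using assms by (simp only: weight_add weight_bump)
qed

lemma prod_bump:
  assumes "i0 \<in> {1..r}" "\<And>i. f i 0 = 1"
  shows "(\<Prod>i=1..r. f i (bump i0 m i)) = f i0 m"
proof -
  have "(\<Prod>i=1..r. f i (bump i0 m i)) = f i0 (bump i0 m i0) * (\<Prod>i\<in>{1..r} - {i0}. f i (bump i0 m i))"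
    using assms by (intro prod.remove) auto
  also have "(\<Prod>i\<in>{1..r} - {i0}. f i (bump i0 m i)) = 1"
    using assms by (intro prod.neutral) (auto simp: bump_def)
  finally show ?thesis by (simp add: bump_def)
qed

text \<open>Only pairs containing i0 change. The prefactor x_j makes each factor of
  \<open>Delta\<close> antisymmetric in its two variables, so the ratio of new to old factor is the
  same whether i0 is the smaller or the larger index.\<close>

lemma Delta_bump:
  assumes p: "norm p < 1" and q: "q \<noteq> 0" and i0: "i0 \<in> {1..r}"
    and x: "\<And>i. i \<in> {1..r} \<Longrightarrow> x i \<noteq> 0"
  shows "Delta r p (\<lambda>i. x i * q ^ (2 * bump i0 m i)) * (\<Prod>j\<in>{1..r} - {i0}. theta p (x i0 / x j))
    = Delta r p x * (\<Prod>j\<in>{1..r} - {i0}. theta p ((q\<^sup>2) ^ m * (x i0 / x j)))"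
proof -
  define S where "S = {(i, j). 1 \<le> i \<and> i < j \<and> j \<le> r}"
  define T where "T = {(i, j) \<in> S. i = i0 \<or> j = i0}"
  define R where "R = {1..r} - {i0}"
  define g where "g = (\<lambda>(x :: nat \<Rightarrow> complex) (i, j). x j * theta p (x i / x j))"
  define y where "y = (\<lambda>i. x i * q ^ (2 * bump i0 m i))"
  have "finite S"
    by (rule finite_subset[of _ "{1..r} \<times> {1..r}"]) (auto simp: S_def)
  have split: "Delta r p z = (\<Prod>s\<in>S - T. g z s) * (\<Prod>j\<in>R. g z (min i0 j, max i0 j))" for z
  proof -
    have "Delta r p z = (\<Prod>s\<in>S. g z s)"
      by (simp add: Delta_def S_def g_def case_prod_unfold)
    also have "\<dots> = (\<Prod>s\<in>S - T. g z s) * (\<Prod>s\<in>T. g z s)"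
      using \<open>finite S\<close> by (intro prod.subset_diff) (auto simp: T_def)
    also have "(\<Prod>s\<in>T. g z s) = (\<Prod>j\<in>R. g z (min i0 j, max i0 j))"
      by (rule prod.reindex_bij_witness[of _ "\<lambda>j. (min i0 j, max i0 j)" "\<lambda>(i, j). if i = i0 then j else i"])
        (use i0 in \<open>auto simp: T_def S_def R_def min_def max_def split: if_splits\<close>)
    finally show ?thesis .
  qed
  have rest: "(\<Prod>s\<in>S - T. g y s) = (\<Prod>s\<in>S - T. g x s)"
    by (intro prod.cong) (auto simp: T_def g_def y_def bump_def split: if_splits)
  have pairs: "g y (min i0 j, max i0 j) * theta p (x i0 / x j)
      = g x (min i0 j, max i0 j) * theta p ((q\<^sup>2) ^ m * (x i0 / x j))" if "j \<in> R" for j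
  proof -
    have nz: "x j \<noteq> 0" "x i0 \<noteq> 0" "j \<noteq> i0" using that x i0 by (auto simp: R_def)
    have y: "y j = x j" "y i0 = (q\<^sup>2) ^ m * x i0" using nz by (simp_all add: y_def bump_def power_mult)
    show ?thesis
    proof (cases "i0 < j")
      case True
      then show ?thesis by (simp add: g_def y min_def max_def mult_ac)
    next
      case False
      have "theta p (x j / ((q\<^sup>2) ^ m * x i0)) = - (x j / ((q\<^sup>2) ^ m * x i0)) * theta p ((q\<^sup>2) ^ m * x i0 / x j)"
        using nz q by (intro theta_swap[OF p]) auto
      moreover have "theta p (x j / x i0) = - (x j / x i0) * theta p (x i0 / x j)"
        using nz by (intro theta_swap[OF p]) auto
      ultimately show ?thesis
        using False nz q by (simp add: g_def y min_def max_def)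
    qed
  qed
  have "Delta r p y * (\<Prod>j\<in>R. theta p (x i0 / x j))
      = (\<Prod>s\<in>S - T. g x s) * (\<Prod>j\<in>R. g y (min i0 j, max i0 j) * theta p (x i0 / x j))"
    unfolding split rest by (simp add: prod.distrib mult.assoc)
  also have "\<dots> = (\<Prod>s\<in>S - T. g x s) * (\<Prod>j\<in>R. g x (min i0 j, max i0 j) * theta p ((q\<^sup>2) ^ m * (x i0 / x j)))"
    by (rule arg_cong2[of _ _ _ _ "(*)", OF refl prod.cong[OF refl pairs]])
  also have "\<dots> = Delta r p x * (\<Prod>j\<in>R. theta p ((q\<^sup>2) ^ m * (x i0 / x j)))"
    unfolding split by (simp add: prod.distrib mult.assoc)
  finally show ?thesis unfolding R_def y_def .
qed

definition summand :: "complex \<Rightarrow> complex \<Rightarrow> nat \<Rightarrow> complex \<Rightarrow> complex \<Rightarrow> complex \<Rightarrow> complex \<Rightarrow>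
    (nat \<Rightarrow> complex) \<Rightarrow> (nat \<Rightarrow> nat) \<Rightarrow> (nat \<Rightarrow> nat) \<Rightarrow> complex" where
  "summand p q r c d a b x n k =
        Delta r p (\<lambda>i. x i * q ^ (2 * k i)) / Delta r p x
        * (efacs q p [b, q / b] (weight r k) / efacs q p [a * q / c, a * q / d] (weight r k))
        * q ^ weight r k
        * (\<Prod>i=1..r. \<Prod>j=1..r.
             efac (q ^ 2) p (q powi (- 2 * int (n j)) * x i / x j) (k i)
             / efac (q ^ 2) p (q ^ 2 * x i / x j) (k i))
        * (\<Prod>i=1..r.
             theta p (a * x i * q ^ (weight r k + 2 * k i)) / theta p (a * x i)
             * (efac q p (a * x i) (weight r k)
                / efac q p (a * x i * q ^ (2 * n i + 1)) (weight r k))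
             * (efacs (q ^ 2) p [c * x i, d * x i] (k i)
                / efacs (q ^ 2) p [a * x i * q ^ 2 / b, a * b * x i * q] (k i)))"

definition closed_form :: "complex \<Rightarrow> complex \<Rightarrow> nat \<Rightarrow> complex \<Rightarrow> complex \<Rightarrow> complex \<Rightarrow>
    (nat \<Rightarrow> complex) \<Rightarrow> (nat \<Rightarrow> nat) \<Rightarrow> complex" where
  "closed_form p q r c a b x n =
       efacs (q ^ 2) p [a * q ^ 2 / (b * c), a * b * q / c] (weight r n)
       / efac q p (a * q / c) (2 * weight r n)
       * (\<Prod>i=1..r.
            efac q p (a * x i * q) (2 * n i)
            / efacs (q ^ 2) p [a * x i * q ^ 2 / b, a * b * x i * q] (n i))"

section \<open>Separating the dependence on b\<close>

context
  fixes p q c d :: complex and r :: nat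
  assumes p: "norm p < 1" and q: "q \<noteq> 0" and c: "c \<noteq> 0" and d: "d \<noteq> 0"
begin

private abbreviation "E \<equiv> efac q p"
private abbreviation "E2 \<equiv> efac (q\<^sup>2) p"
private abbreviation "W \<equiv> weight r"

text \<open>\<open>coef\<close> collects what does not involve \<open>b\<close>. A summand has the
  denominator \<open>bden a x k b\<close>; enlarging it to \<open>bden a x n b\<close> moves the
  missing factors into \<open>bnum\<close>, so that all terms share one denominator and all
  numerators have the same degree.\<close>

definition "coef a x n k =
  Delta r p (\<lambda>i. x i * q ^ (2 * k i)) / Delta r p x * q ^ W k / (E (a * q / c) (W k) * E (a * q / d) (W k))
  * ((\<Prod>i=1..r. \<Prod>j=1..r. E2 (x i / (x j * q ^ (2 * n j))) (k i)) / (\<Prod>i=1..r. \<Prod>j=1..r. E2 (q\<^sup>2 * x i / x j) (k i)))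
  * ((\<Prod>i=1..r. theta p (a * x i * q ^ (W k + 2 * k i))) / (\<Prod>i=1..r. theta p (a * x i)))
  * ((\<Prod>i=1..r. E (a * x i) (W k)) / (\<Prod>i=1..r. E (a * x i * q ^ (2 * n i + 1)) (W k)))
  * (\<Prod>i=1..r. E2 (c * x i) (k i) * E2 (d * x i) (k i))"

definition "bnum a x n k b = E b (W k) * E (q / b) (W k)
  * (\<Prod>i=1..r. E2 (a * x i * q\<^sup>2 / b * q ^ (2 * k i)) (n i - k i) * E2 (a * b * x i * q * q ^ (2 * k i)) (n i - k i))"

definition "bden a x n b = (\<Prod>i=1..r. E2 (a * x i * q\<^sup>2 / b) (n i) * E2 (a * b * x i * q) (n i))"

lemma summand_eq_quotient:
  "summand p q r c d a b x n k = coef a x n k * (E b (W k) * E (q / b) (W k)) / bden a x k b"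
  unfolding summand_def coef_def bden_def efacs_pair power_int_neg_double prod.distrib prod_dividef
  by (simp add: divide_inverse mult_ac)

lemma efac_split_le:
  assumes "k \<le> n"
  shows "E2 u n = E2 u k * E2 (u * q ^ (2 * k)) (n - k)"
  using efac_add[of "q\<^sup>2" p u k "n - k"] assms by (simp add: power_mult)

lemma bden_split:
  assumes "\<And>i. i \<in> {1..r} \<Longrightarrow> k i \<le> n i"
  shows "bden a x n b = bden a x k b * (\<Prod>i=1..r. E2 (a * x i * q\<^sup>2 / b * q ^ (2 * k i)) (n i - k i)
    * E2 (a * b * x i * q * q ^ (2 * k i)) (n i - k i))"
  unfolding bden_def prod.distrib[symmetric]
  by (intro prod.cong refl) (simp only: efac_split_le[OF assms] mult_ac)

lemma summand_eq:
  assumes "\<And>i. i \<in> {1..r} \<Longrightarrow> k i \<le> n i" "bden a x n b \<noteq> 0"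
  shows "summand p q r c d a b x n k = coef a x n k * bnum a x n k b / bden a x n b"
  using bden_split[of k n a x b, OF assms(1)] assms(2)
  by (simp add: summand_eq_quotient bnum_def field_simps)

definition "numer a x n b = (\<Prod>i=1..r. E (a * x i * q) (2 * n i)) / E (a * q / c) (2 * W n)
  * (E2 (a * q\<^sup>2 / (b * c)) (W n) * E2 (a * b * q / c) (W n))"

lemma closed_form_eq: "closed_form p q r c a b x n = numer a x n b / bden a x n b"
  by (simp add: closed_form_def numer_def bden_def efacs_pair prod_dividef)

section \<open>Shifting one summation index at b = a x_i0 q^(2m)\<close>

context
  fixes a :: complex and x :: "nat \<Rightarrow> complex" and n :: "nat \<Rightarrow> nat" and i0 m :: nat
  assumes a: "a \<noteq> 0" and x: "\<And>i. i \<in> {1..r} \<Longrightarrow> x i \<noteq> 0"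
    and i0: "i0 \<in> {1..r}" and m: "m \<le> n i0"
begin

private abbreviation "x' \<equiv> \<lambda>i. x i * q ^ (2 * bump i0 m i)"
private abbreviation "n' \<equiv> \<lambda>i. n i - bump i0 m i"
private abbreviation "a' \<equiv> a * q ^ m"
text \<open>Besides \<open>a' * b' = a * b0\<close>, one has \<open>b0 * q ^ m = a' * x' i0\<close>
  and \<open>b' = a * x i0 * q ^ m\<close>: the shift exchanges the roles of \<open>b\<close> and of
  a x_i0.\<close>

private abbreviation "b0 \<equiv> a * x i0 * q ^ (2 * m)"
private abbreviation "b' \<equiv> a * x i0 * q ^ m"

lemma q2m: "q ^ (2 * m) = q ^ m * q ^ m"
  by (simp add: mult_2 power_add)

lemma q3m: "q ^ (3 * m) = q ^ m * q ^ m * q ^ m"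
  using power_add[of q "2 * m" m] by (simp add: q2m)

lemma bump_le: "bump i0 m i \<le> n i"
  using m by (simp add: bump_def)

text \<open>A factorial of length k + bump splits into one of length bump and one in the shifted
  parameters, up to two exchanges. In \<open>swap1\<close> the run from \<open>b0\<close> continues
  as the new run from \<open>a' * x' i0\<close>, while the one from a x_i0 continues as the run from
  \<open>b'\<close>. In \<open>swap2\<close> the denominators q^2 x_i / x_j with j = i0 trade places
  with those in a x_i q^2 / b.\<close>

lemma term_shift:
  assumes Delta: "Delta r p x' \<noteq> 0" and theta: "(\<Prod>i=1..r. theta p (a' * x' i)) \<noteq> 0"
    and bden: "bden a' x' n' b' \<noteq> 0"
    and BR: "(\<Prod>i=1..r. E2 (a * x i * q\<^sup>2 / b0 * q ^ (2 * bump i0 m i)) (n' i)) \<noteq> 0"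
    and k: "\<And>i. i \<in> {1..r} \<Longrightarrow> k i \<le> n' i"
  shows "coef a x n (\<lambda>i. k i + bump i0 m i) * bnum a x n (\<lambda>i. k i + bump i0 m i) b0
    = coef a x n (bump i0 m) * bnum a x n (bump i0 m) b0 * summand p q r c d a' b' x' n' k"
proof -
  let ?k = "\<lambda>i. k i + bump i0 m i"
  have x0: "x i0 \<noteq> 0" using x i0 by simp
  have x'0: "x' i0 \<noteq> 0" "x' i0 = x i0 * q ^ (2 * m)" using x0 q by (simp_all add: bump_def)
  have W1: "W ?k = m + W k" using i0 by (simp add: weight_add weight_bump)
  have W2: "W (bump i0 m) = m" using i0 by (simp add: weight_bump)
  have add: "E2 u (k i + bump i0 m i) = E2 u (bump i0 m i) * E2 (u * q ^ (2 * bump i0 m i)) (k i)" for u i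
    using efac_add[of "q\<^sup>2" p u "bump i0 m i" "k i"] by (simp add: power_mult add.commute)
  have Dl: "Delta r p (\<lambda>i. x i * q ^ (2 * ?k i)) = Delta r p (\<lambda>i. x' i * q ^ (2 * k i))"
    by (rule arg_cong[of _ _ "Delta r p"]) (simp add: algebra_simps power_add)
  have Ac: "E (a * q / c) (m + W k) = E (a * q / c) m * E (a' * q / c) (W k)"
    and Ad: "E (a * q / d) (m + W k) = E (a * q / d) m * E (a' * q / d) (W k)"
    by (simp_all add: efac_add mult_ac)
  \<comment> \<open>The product x_j q^(2 n_j) is unchanged when x_j is multiplied by q^(2m) and n_j
    lowered by m.\<close>
  have NN: "(\<Prod>i=1..r. \<Prod>j=1..r. E2 (x i / (x j * q ^ (2 * n j))) (?k i))
    = (\<Prod>i=1..r. \<Prod>j=1..r. E2 (x i / (x j * q ^ (2 * n j))) (bump i0 m i))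
      * (\<Prod>i=1..r. \<Prod>j=1..r. E2 (x' i / (x' j * q ^ (2 * n' j))) (k i))"
    unfolding add prod.distrib
  proof (intro arg_cong2[of _ _ _ _ "(*)"] prod.cong refl)
    fix i j assume "j \<in> {1..r}"
    have "2 * n j = 2 * bump i0 m j + 2 * n' j"
      using bump_le[of j] by simp
    then have "q ^ (2 * n j) = q ^ (2 * bump i0 m j) * q ^ (2 * n' j)"
      by (simp only: power_add)
    then show "E2 (x i / (x j * q ^ (2 * n j)) * q ^ (2 * bump i0 m i)) (k i)
        = E2 (x' i / (x' j * q ^ (2 * n' j))) (k i)"
      by (simp only: times_divide_eq_left times_divide_eq_right mult_ac)
  qed
  have DD: "(\<Prod>i=1..r. \<Prod>j=1..r. E2 (q\<^sup>2 * x i / x j) (?k i))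
    = (\<Prod>i=1..r. \<Prod>j=1..r. E2 (q\<^sup>2 * x i / x j) (bump i0 m i))
      * (\<Prod>i=1..r. \<Prod>j=1..r. E2 (q\<^sup>2 * x' i / x j) (k i))"
    unfolding add prod.distrib by (simp add: mult_ac)
  have TH: "(\<Prod>i=1..r. theta p (a * x i * q ^ (m + W k + 2 * ?k i)))
      = (\<Prod>i=1..r. theta p (a' * x' i * q ^ (W k + 2 * k i)))"
    by (intro prod.cong refl arg_cong[of _ _ "theta p"]) (simp add: power_add distrib_left mult_ac)
  have TH0: "(\<Prod>i=1..r. theta p (a * x i * q ^ (m + 2 * bump i0 m i))) = (\<Prod>i=1..r. theta p (a' * x' i))"
    by (intro prod.cong refl arg_cong[of _ _ "theta p"]) (simp add: power_add mult_ac)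
  have AX: "(\<Prod>i=1..r. E (a * x i) (m + W k)) = (\<Prod>i=1..r. E (a * x i) m) * (\<Prod>i=1..r. E (a * x i * q ^ m) (W k))"
    by (simp add: efac_add prod.distrib)
  have AN: "(\<Prod>i=1..r. E (a * x i * q ^ (2 * n i + 1)) (m + W k))
    = (\<Prod>i=1..r. E (a * x i * q ^ (2 * n i + 1)) m) * (\<Prod>i=1..r. E (a' * x' i * q ^ (2 * n' i + 1)) (W k))"
    unfolding efac_add prod.distrib
  proof (intro arg_cong2[of _ _ _ _ "(*)"] prod.cong refl)
    fix i
    have "q ^ (2 * n i + 1) = q ^ (2 * bump i0 m i) * q ^ (2 * n' i + 1)"
    proof -
      have "2 * n i + 1 = 2 * bump i0 m i + (2 * n' i + 1)"
        using bump_le[of i] by simp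
      then show ?thesis by (simp only: power_add)
    qed
    then show "E (a * x i * q ^ (2 * n i + 1) * q ^ m) (W k) = E (a' * x' i * q ^ (2 * n' i + 1)) (W k)"
      by (simp only: mult_ac)
  qed
  have CD: "(\<Prod>i=1..r. E2 (c * x i) (?k i) * E2 (d * x i) (?k i))
    = (\<Prod>i=1..r. E2 (c * x i) (bump i0 m i) * E2 (d * x i) (bump i0 m i))
      * (\<Prod>i=1..r. E2 (c * x' i) (k i) * E2 (d * x' i) (k i))"
    unfolding add prod.distrib by (simp only: mult_ac)
  have Bb: "E b0 (m + W k) = E b0 m * E (b0 * q ^ m) (W k)" by (rule efac_add)
  have Bq: "E (q / b0) (m + W k) = E (q / b0) m * E (q / b') (W k)"
  proof -
    have "q / b0 * q ^ m = q / b'"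
      using a x0 q by (simp add: field_simps mult_2_right power_add)
    then show ?thesis by (simp add: efac_add)
  qed
  have swap1: "E (b0 * q ^ m) (W k) * (\<Prod>i=1..r. E (a * x i * q ^ m) (W k))
    = E b' (W k) * (\<Prod>i=1..r. E (a' * x' i) (W k))"
  proof -
    have "(\<Prod>i=1..r. E (a * x i * q ^ m) (W k)) = E b' (W k) * (\<Prod>i\<in>{1..r} - {i0}. E (a * x i * q ^ m) (W k))"
      using i0 by (intro prod.remove) auto
    moreover have "(\<Prod>i=1..r. E (a' * x' i) (W k)) = E (a' * x' i0) (W k) * (\<Prod>i\<in>{1..r} - {i0}. E (a' * x' i) (W k))"
      using i0 by (intro prod.remove) auto
    moreover have "(\<Prod>i\<in>{1..r} - {i0}. E (a' * x' i) (W k)) = (\<Prod>i\<in>{1..r} - {i0}. E (a * x i * q ^ m) (W k))"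
      by (intro prod.cong refl) (simp add: bump_def mult_ac)
    ultimately show ?thesis by (simp add: bump_def mult_ac)
  qed
  \<comment> \<open>\<open>R\<close> is the excess of the \<open>b\<close>-factors of the
    \<open>bump\<close> term over those of the \<open>k + bump\<close> term: runs of length n - bump
    against n - bump - k.\<close>
  define R where "R = (\<Prod>i=1..r. E2 (a * x i * q\<^sup>2 / b0 * q ^ (2 * bump i0 m i)) (k i)
      * E2 (a * b0 * x i * q * q ^ (2 * bump i0 m i)) (k i))"
  have R_ne: "R \<noteq> 0"
  proof -
    have "E2 (a * x i * q\<^sup>2 / b0 * q ^ (2 * bump i0 m i)) (k i) \<noteq> 0"
      "E2 (a * b0 * x i * q * q ^ (2 * bump i0 m i)) (k i) \<noteq> 0" if i: "i \<in> {1..r}" for i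
    proof -
      have "E2 (a * x i * q\<^sup>2 / b0 * q ^ (2 * bump i0 m i)) (n' i) \<noteq> 0"
        using BR i by auto
      then show "E2 (a * x i * q\<^sup>2 / b0 * q ^ (2 * bump i0 m i)) (k i) \<noteq> 0"
        by (simp only: efac_split_le[OF k[OF i]]) simp
      have "a' * b' * x' i * q = a * b0 * x i * q * q ^ (2 * bump i0 m i)"
        unfolding q2m by (simp only: mult_ac)
      moreover have "E2 (a' * b' * x' i * q) (n' i) \<noteq> 0"
        using bden i unfolding bden_def by auto
      ultimately show "E2 (a * b0 * x i * q * q ^ (2 * bump i0 m i)) (k i) \<noteq> 0"
        by (simp only: efac_split_le[OF k[OF i]]) simp
    qed
    then show ?thesis by (auto simp: R_def)
  qed
  have BB: "(\<Prod>i=1..r. E2 (a * x i * q\<^sup>2 / b0 * q ^ (2 * bump i0 m i)) (n i - bump i0 m i)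
      * E2 (a * b0 * x i * q * q ^ (2 * bump i0 m i)) (n i - bump i0 m i))
    = R * (\<Prod>i=1..r. E2 (a * x i * q\<^sup>2 / b0 * q ^ (2 * ?k i)) (n i - ?k i)
      * E2 (a * b0 * x i * q * q ^ (2 * ?k i)) (n i - ?k i))"
    unfolding R_def prod.distrib[symmetric]
  proof (intro prod.cong refl)
    fix i assume i: "i \<in> {1..r}"
    have "n' i - k i = n i - ?k i" by simp
    then show "E2 (a * x i * q\<^sup>2 / b0 * q ^ (2 * bump i0 m i)) (n' i) * E2 (a * b0 * x i * q * q ^ (2 * bump i0 m i)) (n' i)
      = E2 (a * x i * q\<^sup>2 / b0 * q ^ (2 * bump i0 m i)) (k i) * E2 (a * b0 * x i * q * q ^ (2 * bump i0 m i)) (k i)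
        * (E2 (a * x i * q\<^sup>2 / b0 * q ^ (2 * ?k i)) (n i - ?k i) * E2 (a * b0 * x i * q * q ^ (2 * ?k i)) (n i - ?k i))"
      by (simp only: efac_split_le[OF k[OF i]] distrib_left power_add mult_ac)
  qed
  have swap2: "(\<Prod>i=1..r. \<Prod>j=1..r. E2 (q\<^sup>2 * x' i / x j) (k i)) * R
    = (\<Prod>i=1..r. \<Prod>j=1..r. E2 (q\<^sup>2 * x' i / x' j) (k i)) * bden a' x' k b'"
    unfolding R_def bden_def prod.distrib[symmetric]
  proof (intro prod.cong refl)
    fix i
    have "(\<Prod>j=1..r. E2 (q\<^sup>2 * x' i / x j) (k i))
      = E2 (q\<^sup>2 * x' i / x i0) (k i) * (\<Prod>j\<in>{1..r} - {i0}. E2 (q\<^sup>2 * x' i / x j) (k i))"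
      using i0 by (intro prod.remove) auto
    moreover have "(\<Prod>j=1..r. E2 (q\<^sup>2 * x' i / x' j) (k i))
      = E2 (q\<^sup>2 * x' i / x' i0) (k i) * (\<Prod>j\<in>{1..r} - {i0}. E2 (q\<^sup>2 * x' i / x' j) (k i))"
      using i0 by (intro prod.remove) auto
    moreover have "(\<Prod>j\<in>{1..r} - {i0}. E2 (q\<^sup>2 * x' i / x' j) (k i))
      = (\<Prod>j\<in>{1..r} - {i0}. E2 (q\<^sup>2 * x' i / x j) (k i))"
      by (intro prod.cong refl) (simp add: bump_def)
    moreover have "a * x i * q\<^sup>2 / b0 * q ^ (2 * bump i0 m i) = q\<^sup>2 * x' i / x' i0"
      unfolding x'0(2) using a x0 q by (simp add: field_simps)
    moreover have "a' * x' i * q\<^sup>2 / b' = q\<^sup>2 * x' i / x i0"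
      using a x0 q by (simp add: field_simps mult_2_right power_add)
    moreover have "a' * b' * x' i * q = a * b0 * x i * q * q ^ (2 * bump i0 m i)"
      unfolding q2m by (simp only: mult_ac)
    ultimately show "(\<Prod>j=1..r. E2 (q\<^sup>2 * x' i / x j) (k i))
        * (E2 (a * x i * q\<^sup>2 / b0 * q ^ (2 * bump i0 m i)) (k i) * E2 (a * b0 * x i * q * q ^ (2 * bump i0 m i)) (k i))
      = (\<Prod>j=1..r. E2 (q\<^sup>2 * x' i / x' j) (k i))
        * (E2 (a' * x' i * q\<^sup>2 / b') (k i) * E2 (a' * b' * x' i * q) (k i))"
      by (simp only: mult_ac)
  qed
  \<comment> \<open>With the factors replaced by variables this is a field identity with three
    relations among them. Only \<open>D1\<close>, \<open>THm\<close> and \<open>R\<close> are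
    cancelled; everywhere else inverses are merely regrouped.\<close>
  have combine: "D2 / D0 * (qm * qK) / (Am * AK * (Bm * BK)) * (NNm * NNK / (DDm * DDK)) * (THK / TH0)
      * (AXm * AXK / (ANm * ANK)) * (CDm * CDK) * (bm * bK * (em * eK) * BBK)
    = D1 / D0 * qm / (Am * Bm) * (NNm / DDm) * (THm / TH0) * (AXm / ANm) * CDm * (bm * em * BBm)
      * (D2 / D1 * qK / (AK * BK) * (NNK / DDP) * (THK / THm) * (AXP / ANK) * CDK * (bP * eK) / BBP)"
    if "D1 \<noteq> 0" "THm \<noteq> 0" "R \<noteq> 0" "BBm = R * BBK" "DDK * R = DDP * BBP" "bK * AXK = bP * AXP"
    for D0 D1 D2 qm qK Am AK Bm BK NNm NNK DDm DDK DDP THK TH0 THm AXm AXK AXP ANm ANK CDm CDK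
      bm bK bP em eK BBK BBm BBP R :: complex
  proof -
    have "BBK / DDK = BBm / (DDP * BBP)"
      using that by (simp flip: that(5))
    then have *: "BBK * inverse DDK = BBm * (inverse DDP * inverse BBP)"
      by (simp add: divide_inverse)
    have "D2 / D0 * (qm * qK) / (Am * AK * (Bm * BK)) * (NNm * NNK / (DDm * DDK)) * (THK / TH0)
        * (AXm * AXK / (ANm * ANK)) * (CDm * CDK) * (bm * bK * (em * eK) * BBK)
      = D2 / D0 * (qm * qK) / (Am * AK * (Bm * BK)) * (NNm * NNK / DDm) * (THK / TH0)
        * (AXm / (ANm * ANK)) * (CDm * CDK) * (bm * (em * eK)) * (bK * AXK) * (BBK * inverse DDK)"
      by (simp add: divide_inverse mult_ac)
    also have "\<dots> = (D1 / D1) * (THm / THm) * (D2 / D0 * (qm * qK) / (Am * AK * (Bm * BK)) * (NNm * NNK / DDm)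
        * (THK / TH0) * (AXm / (ANm * ANK)) * (CDm * CDK) * (bm * (em * eK)) * (bP * AXP)
        * (BBm * (inverse DDP * inverse BBP)))"
      unfolding * that(6) using that(1,2) by simp
    also have "\<dots> = D1 / D0 * qm / (Am * Bm) * (NNm / DDm) * (THm / TH0) * (AXm / ANm) * CDm * (bm * em * BBm)
      * (D2 / D1 * qK / (AK * BK) * (NNK / DDP) * (THK / THm) * (AXP / ANK) * CDK * (bP * eK) / BBP)"
      by (simp only: divide_inverse inverse_mult_distrib mult_ac)
    finally show ?thesis .
  qed
  show ?thesis
    unfolding summand_eq_quotient coef_def bnum_def W1 W2 Dl Ac Ad NN DD TH TH0 AX AN CD Bb Bq power_add[of q m "W k"]
    by (rule combine[OF Delta theta R_ne BB swap2 swap1])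
qed

text \<open>The factors separate into groups, each settled by one identity: the Vandermonde factors
  (\<open>e1\<close>), the indices j \<noteq> i0 (\<open>e2\<close>, \<open>e4\<close>), the index
  i0 (\<open>e3\<close>, \<open>e5\<close>), the parameters c and d (\<open>e6\<close>), and the
  remaining monomials (\<open>e7\<close>, \<open>e8\<close>).\<close>

lemma leading_term:
  assumes bal: "a\<^sup>2 * q ^ (2 * W n + 1) = c * d"
    and D0: "Delta r p x \<noteq> 0"
    and ne: "\<And>l. E (a * q / c) l \<noteq> 0" "\<And>l. E (a * q / d) l \<noteq> 0"
      "\<And>i. i \<in> {1..r} \<Longrightarrow> theta p (a * x i) \<noteq> 0"
      "\<And>i. i \<in> {1..r} \<Longrightarrow> E (a * x i * q ^ (2 * n i + 1)) m \<noteq> 0"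
      "\<And>j. j \<in> {1..r} \<Longrightarrow> E2 (q\<^sup>2 * x i0 / x j) m \<noteq> 0"
      "\<And>j. j \<in> {1..r} - {i0} \<Longrightarrow> theta p (x i0 / x j) \<noteq> 0"
      "\<And>j. j \<in> {1..r} - {i0} \<Longrightarrow> theta p ((q\<^sup>2) ^ m * (x i0 / x j)) \<noteq> 0"
    and bden: "bden a' x' n' b' \<noteq> 0"
  shows "coef a x n (bump i0 m) * bnum a x n (bump i0 m) b0 * closed_form p q r c a' b' x' n' = numer a x n b0"
proof -
  define R where "R = {1..r} - {i0}"
  define N where "N = W n"
  have x0: "x i0 \<noteq> 0" using x i0 by simp
  have x_R: "x j \<noteq> 0" "bump i0 m j = 0" "j \<in> {1..r}" if "j \<in> R" for j
    using that x by (auto simp: R_def bump_def)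
  have bump0: "bump i0 m i0 = m" by (simp add: bump_def)
  have b0: "b0 \<noteq> 0" using a x0 q by simp
  have rem: "(\<Prod>i=1..r. f i) = f i0 * (\<Prod>j\<in>R. f j)" for f :: "nat \<Rightarrow> complex"
    unfolding R_def using i0 by (intro prod.remove) auto
  have W1: "W (bump i0 m) = m" using i0 by (rule weight_bump)
  have N': "W n' = N - m" "m \<le> N"
    unfolding N_def using weight_diff_bump[of i0 r m n] i0 m by simp_all
  have sumR: "N = n i0 + (\<Sum>j\<in>R. n j)"
    unfolding N_def weight_def R_def using i0 by (intro sum.remove) auto
  have congR: "(\<And>j. j \<in> R \<Longrightarrow> f j = g j) \<Longrightarrow> prod f R = prod g R" for f g :: "nat \<Rightarrow> complex"
    by (rule prod.cong[OF refl])
  \<comment> \<open>\<open>T1\<close>, \<open>TQ\<close>, \<open>B1\<close>, \<open>B1'\<close>,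
    \<open>QP\<close> and the names ending in \<open>R\<close> are products over j \<noteq> i0;
    \<open>N0\<close>, \<open>Dd\<close>, \<open>B0\<close>, \<open>B0'\<close> are the matching
    factors at i0. \<open>sb\<close>, \<open>sc\<close>, \<open>sd\<close>, \<open>se\<close> are
    the monomials left by reversals.\<close>
  define T1 where "T1 = (\<Prod>j\<in>R. theta p (x i0 / x j))"
  define TQ where "TQ = (\<Prod>j\<in>R. theta p ((q\<^sup>2) ^ m * (x i0 / x j)))"
  define NR where "NR = (\<Prod>j\<in>R. E2 (x i0 / (x j * q ^ (2 * n j))) m)"
  define DR where "DR = (\<Prod>j\<in>R. E2 (q\<^sup>2 * x i0 / x j) m)"
  define B1 where "B1 = (\<Prod>j\<in>R. E2 (a * x j * q\<^sup>2 / b0) (n j))"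
  define B1' where "B1' = (\<Prod>j\<in>R. E2 (a' * x j * q\<^sup>2 / b') (n j))"
  define QP where "QP = (\<Prod>j\<in>R. (q\<^sup>2) ^ (n j * m))"
  define N0 where "N0 = E2 (x i0 / (x i0 * q ^ (2 * n i0))) m"
  define Dd where "Dd = E2 (q\<^sup>2 * x i0 / x i0) m"
  define B0 where "B0 = E2 (a * x i0 * q\<^sup>2 / b0 * q ^ (2 * m)) (n i0 - m)"
  define B0' where "B0' = E2 (a' * x' i0 * q\<^sup>2 / b') (n i0 - m)"
  define BS where "BS = (\<Prod>i=1..r. E2 (a' * b' * x' i * q) (n' i))"
  define THR where "THR = (\<Prod>j\<in>R. theta p (a * x j * q ^ m))"
  define AXR where "AXR = (\<Prod>j\<in>R. E (a * x j) m)"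
  define KPR where "KPR = (\<Prod>j\<in>R. E (a * x j * q ^ (m + 1)) (2 * n j))"
  define T0R where "T0R = (\<Prod>j\<in>R. theta p (a * x j))"
  define KR where "KR = (\<Prod>j\<in>R. E (a * x j * q) (2 * n j))"
  define ANR where "ANR = (\<Prod>j\<in>R. E (a * x j * q ^ (2 * n j + 1)) m)"
  define F1 where "F1 = E2 (q\<^sup>2 / (c * x i0 * q ^ (2 * m))) N"
  define F2 where "F2 = E2 (a\<^sup>2 * x i0 * q ^ (2 * m + 1) / c) N"
  define F1' where "F1' = E2 (q\<^sup>2 / (c * x i0)) (N - m)"
  define F2' where "F2' = E2 (a\<^sup>2 * x i0 * q ^ (2 * m + 1) / c) (N - m)"
  define sb where "sb = (- q / b0) ^ m * tri q m"
  define sc where "sc = (- c / a) ^ m * tri q m"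
  define se where "se = (- (c * x i0)) ^ m * (tri q m)\<^sup>2"
  define sd where "sd = (- 1) ^ m * (tri q m)\<^sup>2"

  have e1: "Delta r p x' * T1 = Delta r p x * TQ"
    unfolding T1_def TQ_def R_def by (rule Delta_bump[OF p q i0 x])
  have e2: "TQ * NR * B1 * QP = T1 * DR * B1'"
    unfolding TQ_def NR_def B1_def QP_def T1_def DR_def B1'_def prod.distrib[symmetric]
  proof (rule congR)
    fix j assume "j \<in> R"
    note j = x_R[OF this]
    have "x i0 / (x j * q ^ (2 * n j)) = x i0 / x j / (q\<^sup>2) ^ n j"
      "a * x j * q\<^sup>2 / b0 = q\<^sup>2 / ((q\<^sup>2) ^ m * (x i0 / x j))"
      "a' * x j * q\<^sup>2 / b' = q\<^sup>2 / (x i0 / x j)" "q\<^sup>2 * x i0 / x j = q\<^sup>2 * (x i0 / x j)"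
      using a q x0 j by (simp_all add: field_simps) (simp_all add: mult.commute flip: power_mult)
    then show "theta p ((q\<^sup>2) ^ m * (x i0 / x j)) * E2 (x i0 / (x j * q ^ (2 * n j))) m
        * E2 (a * x j * q\<^sup>2 / b0) (n j) * (q\<^sup>2) ^ (n j * m)
      = theta p (x i0 / x j) * E2 (q\<^sup>2 * x i0 / x j) m * E2 (a' * x j * q\<^sup>2 / b') (n j)"
      using efac_shift_ratio[OF p, of "q\<^sup>2" "x i0 / x j" m "n j"] q x0 j by simp
  qed
  have e3: "N0 * B0 * (q\<^sup>2) ^ (n i0 * m) = sd * (Dd * B0')"
  proof -
    have "x i0 / (x i0 * q ^ (2 * n i0)) = 1 / (q\<^sup>2) ^ n i0" "a * x i0 * q\<^sup>2 / b0 * q ^ (2 * m) = q\<^sup>2"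
      "a' * x' i0 * q\<^sup>2 / b' = q\<^sup>2 * (q\<^sup>2) ^ m" "q\<^sup>2 * x i0 / x i0 = q\<^sup>2"
      using a q x0 by (simp_all add: bump0 power_mult)
    then show ?thesis
      unfolding N0_def B0_def sd_def Dd_def B0'_def
      using efac_shift_ratio_diagonal[OF p, of "q\<^sup>2" m "n i0"] q m by (simp add: tri_base_square)
  qed
  have e4: "THR * AXR * KPR = T0R * KR * ANR"
    unfolding THR_def AXR_def KPR_def T0R_def KR_def ANR_def prod.distrib[symmetric]
    by (rule congR) (rule efac_insert_shift[OF p])
  have e5: "theta p (a * x i0 * q ^ (3 * m)) * E (a * x i0) m * E (a * x i0 * q ^ (3 * m + 1)) (2 * (n i0 - m))
      * (E b0 m * E (q / b0) m)
    = theta p (a * x i0) * E (a * x i0 * q ^ (2 * n i0 + 1)) m * E (a * x i0 * q) (2 * n i0) * sb"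
    unfolding sb_def by (rule efac_triple_shift[OF p]) (use q a x0 m in auto)
  have e6: "E2 (c * x i0) m * E2 (d * x i0) m * (F1' * F2') * E (a * q / c) (2 * N) * sc
    = F1 * F2 * se * (E (a * q / c) m * E (a * q / d) m) * E (a' * q / c) (2 * (N - m)) * q ^ (2 * N * m)"
    unfolding F1_def F2_def F1'_def F2'_def sc_def se_def
    by (rule efac_balanced_shift[OF p q a c d x0 N'(2) bal[folded N_def]])
  \<comment> \<open>Each j contributes (q^2)^(n_j m) through \<open>e2\<close> or \<open>e3\<close>;
    together these give the power q^(2Nm) on the right of \<open>e6\<close>.\<close>
  have e7: "QP * (q\<^sup>2) ^ (n i0 * m) = q ^ (2 * N * m)"
  proof -
    have "(\<Sum>j\<in>R. n j * m) + n i0 * m = N * m"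
      unfolding sumR by (simp add: add_mult_distrib sum_distrib_right)
    then show ?thesis
      unfolding QP_def power_sum[symmetric] power_add[symmetric]
      by (simp add: mult.assoc flip: power_mult)
  qed
  \<comment> \<open>\<open>q ^ m\<close> is the factor q^|k| of the term at \<open>bump\<close>. The
    identity is checked after multiplication by b0^m, which clears the denominator of
    \<open>sb\<close>.\<close>
  have e8: "q ^ m * sd * sb * se = sc"
  proof -
    have sb': "b0 ^ m * ((- q / b0) ^ m) = (- q) ^ m"
      using b0 by (simp flip: power_mult_distrib)
    have qq: "(q ^ (2 * m)) ^ m = q ^ (m * m) * q ^ (m * m)"
      by (simp add: mult_2 add_mult_distrib flip: power_mult power_add)
    have t: "tri q m * tri q m * q ^ m = q ^ (m * m)"
      using tri_square[of q m] by (simp add: power2_eq_square)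
    have "q ^ m * sd * sb * se * b0 ^ m
      = q ^ m * q ^ m * (tri q m * tri q m) * (tri q m * tri q m) * ((- 1) ^ m * (- q) ^ m * (- (c * x i0)) ^ m) * tri q m / q ^ m"
      unfolding sd_def sb_def se_def using sb' q by (simp add: power2_eq_square mult_ac)
    also have "\<dots> = (q ^ (m * m)) * (q ^ (m * m)) * ((- 1) ^ m * (- 1) ^ m * ((- 1) ^ m * c ^ m * x i0 ^ m)) * tri q m"
      unfolding t[symmetric] power_minus[of q] power_minus[of "c * x i0"] power_mult_distrib using q by (simp add: mult_ac)
    also have "\<dots> = sc * b0 ^ m"
      unfolding sc_def power_mult_distrib qq power_divide power_minus[of c] using a
      by (simp add: mult_ac)
    finally show ?thesis using b0 q by simp
  qed
  have T1: "T1 \<noteq> 0" and TQ: "TQ \<noteq> 0"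
    using ne(6,7) by (simp_all add: T1_def TQ_def R_def)
  have QP: "QP \<noteq> 0" and sc: "sc \<noteq> 0"
    using q a c tri_nonzero[OF q] by (auto simp: QP_def sc_def R_def)
  have THeq: "(\<Prod>i=1..r. theta p (a * x i * q ^ (m + 2 * bump i0 m i))) = theta p (a * x i0 * q ^ (3 * m)) * THR"
    unfolding rem THR_def bump0 by (simp add: x_R cong: prod.cong) 
  have NNeq: "(\<Prod>i=1..r. \<Prod>j=1..r. E2 (x i / (x j * q ^ (2 * n j))) (bump i0 m i)) = N0 * NR"
    unfolding N0_def NR_def rem[of "\<lambda>j. E2 (x i0 / (x j * q ^ (2 * n j))) m", symmetric]
    by (rule prod_bump[OF i0]) simp
  have DDeq: "(\<Prod>i=1..r. \<Prod>j=1..r. E2 (q\<^sup>2 * x i / x j) (bump i0 m i)) = Dd * DR"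
    unfolding Dd_def DR_def rem[of "\<lambda>j. E2 (q\<^sup>2 * x i0 / x j) m", symmetric]
    by (rule prod_bump[OF i0]) simp
  have CDeq: "(\<Prod>i=1..r. E2 (c * x i) (bump i0 m i) * E2 (d * x i) (bump i0 m i)) = E2 (c * x i0) m * E2 (d * x i0) m"
    by (rule prod_bump[OF i0]) simp
  have Beq: "(\<Prod>i=1..r. E2 (a * x i * q\<^sup>2 / b0 * q ^ (2 * bump i0 m i)) (n' i)
      * E2 (a * b0 * x i * q * q ^ (2 * bump i0 m i)) (n' i)) = B0 * B1 * BS"
  proof -
    have "(\<Prod>i=1..r. E2 (a * x i * q\<^sup>2 / b0 * q ^ (2 * bump i0 m i)) (n' i)) = B0 * B1"
      unfolding rem B0_def B1_def bump0 by (simp add: x_R cong: prod.cong)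
    moreover have "(\<Prod>i=1..r. E2 (a * b0 * x i * q * q ^ (2 * bump i0 m i)) (n' i)) = BS"
      unfolding BS_def q2m by (simp only: mult_ac)
    ultimately show ?thesis by (simp only: prod.distrib)
  qed
  have bden_eq: "bden a' x' n' b' = B0' * B1' * BS"
  proof -
    have "(\<Prod>i=1..r. E2 (a' * x' i * q\<^sup>2 / b') (n' i)) = B0' * B1'"
      unfolding rem B0'_def B1'_def bump0 by (simp add: x_R cong: prod.cong)
    then show ?thesis by (simp only: bden_def prod.distrib BS_def)
  qed
  have Keq: "(\<Prod>i=1..r. E (a' * x' i * q) (2 * n' i)) = E (a * x i0 * q ^ (3 * m + 1)) (2 * (n i0 - m)) * KPR"
  proof -
    have "a' * (x i0 * q ^ (2 * m)) * q = a * x i0 * q ^ (3 * m + 1)"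
      unfolding power_add q3m q2m by (simp add: mult_ac)
    moreover have "(\<Prod>j\<in>R. E (a' * x' j * q) (2 * n' j)) = KPR"
      unfolding KPR_def by (rule congR) (simp add: x_R power_add mult_ac)
    ultimately show ?thesis unfolding rem bump0 by (simp only:)
  qed
  have Feq: "a * q\<^sup>2 / (b0 * c) = q\<^sup>2 / (c * x i0 * q ^ (2 * m))" "a * b0 * q / c = a\<^sup>2 * x i0 * q ^ (2 * m + 1) / c"
    "a' * q\<^sup>2 / (b' * c) = q\<^sup>2 / (c * x i0)" "a' * b' * q / c = a\<^sup>2 * x i0 * q ^ (2 * m + 1) / c"
    using a c x0 q by (simp_all add: field_simps power2_eq_square) (simp_all add: mult_2_right power_add)
  have combine: "D1 / D0 * qm / (A1 * A2) * (N0 * NR / (Dd * DR)) * (th * THR / (t0 * T0R)) * (ax * AXR / (an * ANR))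
      * CD * (bm * bq * (B0 * B1 * BS)) * (kp * KPR / E1' * (F1' * F2') / (B0' * B1' * BS))
      = k0 * KR / E1 * (F1 * F2)"
    if e: "D1 * T1 = D0 * TQ" "TQ * NR * B1 * QP = T1 * DR * B1'" "N0 * B0 * Q0 = sd * (Dd * B0')"
      "THR * AXR * KPR = T0R * KR * ANR" "th * ax * kp * (bm * bq) = t0 * an * k0 * sb"
      "CD * (F1' * F2') * E1 * sc = F1 * F2 * se * (A1 * A2) * E1' * Q2" "QP * Q0 = Q2" "qm * sd * sb * se = sc"
      and nz: "T1 \<noteq> 0" "TQ \<noteq> 0" "QP \<noteq> 0" "Q0 \<noteq> 0" "sc \<noteq> 0" "D0 \<noteq> 0" "A1 \<noteq> 0" "A2 \<noteq> 0" "Dd \<noteq> 0" "DR \<noteq> 0"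
        "t0 \<noteq> 0" "T0R \<noteq> 0" "an \<noteq> 0" "ANR \<noteq> 0" "E1' \<noteq> 0" "B0' \<noteq> 0" "B1' \<noteq> 0" "BS \<noteq> 0" "E1 \<noteq> 0"
    for D0 D1 qm A1 A2 N0 NR Dd DR th THR t0 T0R ax AXR an ANR CD bm bq B0 B1 BS kp KPR E1' F1' F2' B0' B1' k0 KR E1 F1 F2
      T1 TQ QP Q0 Q2 sb sc sd se :: complex
  proof -
    let ?num = "D1 * qm * (N0 * NR) * (th * THR) * (ax * AXR) * CD * (bm * bq * (B0 * B1 * BS)) * (kp * KPR * (F1' * F2'))"
    let ?den = "D0 * (A1 * A2) * (Dd * DR) * (t0 * T0R) * (an * ANR) * (E1' * (B0' * B1' * BS))"
    \<comment> \<open>The auxiliary factors of the relations; when all relations are multiplied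
      together they appear on both sides.\<close>
    let ?Z = "T1 * TQ * QP * Q0 * sc"
    have "?num * E1 * ?Z = (D1 * T1) * (TQ * NR * B1 * QP) * (N0 * B0 * Q0) * (THR * AXR * KPR)
      * (th * ax * kp * (bm * bq)) * (CD * (F1' * F2') * E1 * sc) * (qm * BS)"
      by (simp only: mult_ac)
    also have "\<dots> = (k0 * KR * (F1 * F2)) * ?den * (T1 * TQ * Q2 * (qm * sd * sb * se))"
      unfolding e(1-6) by (simp only: mult_ac)
    also have "\<dots> = (k0 * KR * (F1 * F2)) * ?den * ?Z"
      unfolding e(8) e(7)[symmetric] by (simp only: mult_ac)
    finally have "?num * E1 = (k0 * KR * (F1 * F2)) * ?den"
      using nz by simp
    moreover have den: "?den \<noteq> 0" using nz by simp
    ultimately have "?num / ?den = k0 * KR * (F1 * F2) / E1"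
      by (simp only: frac_eq_eq[OF den nz(19)])
    then show ?thesis
      by (simp add: divide_inverse mult_ac)
  qed
  have nzs: "theta p (a * x i0) \<noteq> 0" "T0R \<noteq> 0" "E (a * x i0 * q ^ (2 * n i0 + 1)) m \<noteq> 0" "ANR \<noteq> 0" "Dd \<noteq> 0" "DR \<noteq> 0"
    using ne(3-5) i0 ne(5)[OF i0] by (auto simp: T0R_def ANR_def Dd_def DR_def R_def simp del: One_nat_def nonzero_mult_div_cancel_right)
  have E1'_ne: "E (a' * q / c) (2 * (N - m)) \<noteq> 0"
    using ne(1)[of "m + 2 * (N - m)"] by (simp add: efac_add mult_ac)
  have Bs: "B0' \<noteq> 0" "B1' \<noteq> 0" "BS \<noteq> 0"
    using bden unfolding bden_eq by auto
  have T0eq: "(\<Prod>i=1..r. theta p (a * x i)) = theta p (a * x i0) * T0R"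
    "(\<Prod>i=1..r. E (a * x i) m) = E (a * x i0) m * AXR"
    "(\<Prod>i=1..r. E (a * x i * q ^ (2 * n i + 1)) m) = E (a * x i0 * q ^ (2 * n i0 + 1)) m * ANR"
    "(\<Prod>i=1..r. E (a * x i * q) (2 * n i)) = E (a * x i0 * q) (2 * n i0) * KR"
    unfolding rem T0R_def AXR_def ANR_def KR_def by simp_all
  show ?thesis
    unfolding closed_form_eq coef_def bnum_def numer_def W1 N' N_def[symmetric] NNeq DDeq THeq CDeq Beq bden_eq Keq T0eq Feq
      F1_def[symmetric] F2_def[symmetric] F1'_def[symmetric] F2'_def[symmetric]
    by (rule combine[OF e1 e2 e3 e4 e5 e6 e7 e8 T1 TQ QP _ sc D0 ne(1) ne(2) nzs(5,6) nzs(1,2,3,4) E1'_ne Bs ne(1)])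
      (use q in simp)
qed

end

end

section \<open>Generic parameters\<close>

context
  fixes p q :: complex
  assumes p: "norm p < 1" and q: "q \<noteq> 0"
begin

lemma theta_form_efac:
  assumes "theta_form p q N f" "u \<noteq> 0" "s \<noteq> 0"
  shows "theta_form p q (N + l) (\<lambda>b. f b * (efac s p (u * b) l * efac s p (u * q / b) l))"
proof (induction l)
  case 0
  then show ?case using assms by simp
next
  case (Suc l)
  have "(\<lambda>b. f b * (efac s p (u * b) (Suc l) * efac s p (u * q / b) (Suc l)))
    = (\<lambda>b. f b * (efac s p (u * b) l * efac s p (u * q / b) l) * pair p q (u * s ^ l) b)"
    by (intro ext) (simp add: efac_Suc pair_def mult_ac)
  then show ?case
    using theta_form.mult[OF p q Suc, of "u * s ^ l"] assms by simp
qed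

lemma theta_form_prod_efac:
  assumes "finite A" "theta_form p q N f" "\<And>i. i \<in> A \<Longrightarrow> u i \<noteq> 0" "s \<noteq> 0"
  shows "theta_form p q (N + (\<Sum>i\<in>A. l i))
    (\<lambda>b. f b * (\<Prod>i\<in>A. efac s p (u i * b) (l i) * efac s p (u i * q / b) (l i)))"
  using assms(1,3)
proof (induction rule: finite_induct)
  case empty
  then show ?case using assms by simp
next
  case (insert i A)
  then show ?case
    using theta_form_efac[of "N + (\<Sum>i\<in>A. l i)"
        "\<lambda>b. f b * (\<Prod>i\<in>A. efac s p (u i * b) (l i) * efac s p (u i * q / b) (l i))" "u i" s "l i"] assms(4)
    by (simp add: mult_ac add_ac)
qed

lemma theta_generic_efac:
  assumes "\<And>k::int. theta p (z * q powi k) \<noteq> 0"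
  shows "efac q p (z * q ^ s) l \<noteq> 0"
    and "efac (q\<^sup>2) p (z * q ^ s) l \<noteq> 0"
proof -
  have 1: "z * q ^ s * q ^ j = z * q powi int (s + j)" for j
    by (simp only: power_int_of_nat power_add mult.assoc)
  have "theta p (z * q ^ s * q ^ j) \<noteq> 0" for j
    unfolding 1 by (rule assms)
  then show "efac q p (z * q ^ s) l \<noteq> 0"
    unfolding efac_eq_0_iff by blast
  have 2: "z * q ^ s * (q\<^sup>2) ^ j = z * q powi int (s + 2 * j)" for j
    by (simp only: power_int_of_nat power_add power_mult mult.assoc)
  have "theta p (z * q ^ s * (q\<^sup>2) ^ j) \<noteq> 0" for j
    unfolding 2 by (rule assms)
  then show "efac (q\<^sup>2) p (z * q ^ s) l \<noteq> 0"
    unfolding efac_eq_0_iff by blast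
qed

end

text \<open>
  Only \<open>a\<close> is perturbed at the end, so on the ratios \<open>x i / x j\<close> no more may be required than what
  the nonvanishing denominators give; this bounds the exponents \<open>k\<close> in the last condition.
\<close>

definition generic_params :: "complex \<Rightarrow> complex \<Rightarrow> nat \<Rightarrow> complex \<Rightarrow> complex \<Rightarrow> (nat \<Rightarrow> complex) \<Rightarrow> (nat \<Rightarrow> nat) \<Rightarrow> bool" where
  "generic_params p q r c a x n \<longleftrightarrow>
    (\<forall>i\<in>{1..r}. x i \<noteq> 0) \<and>
    (\<forall>i\<in>{1..r}. \<forall>k::int. theta p (a * x i * q powi k) \<noteq> 0) \<and>
    (\<forall>i\<in>{1..r}. \<forall>j\<in>{1..r}. \<forall>k::int. theta p (a\<^sup>2 * x i * x j * q powi k) \<noteq> 0) \<and>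
    (\<forall>k::int. theta p (a / c * q powi k) \<noteq> 0) \<and>
    (\<forall>i\<in>{1..r}. \<forall>j\<in>{1..r}. \<forall>k::int. - int (n j) \<le> k \<longrightarrow> k \<le> int (n i) \<longrightarrow> i \<noteq> j \<or> k \<noteq> 0 \<longrightarrow>
      theta p (x i / x j * q powi (2 * k)) \<noteq> 0)"

lemma generic_paramsD:
  assumes "generic_params p q r c a x n"
  shows "\<And>i. i \<in> {1..r} \<Longrightarrow> x i \<noteq> 0"
    and "\<And>i k. i \<in> {1..r} \<Longrightarrow> theta p (a * x i * q powi k) \<noteq> 0"
    and "\<And>i j k. i \<in> {1..r} \<Longrightarrow> j \<in> {1..r} \<Longrightarrow> theta p (a\<^sup>2 * x i * x j * q powi k) \<noteq> 0"
    and "\<And>k. theta p (a / c * q powi k) \<noteq> 0"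
    and "\<And>i j k. i \<in> {1..r} \<Longrightarrow> j \<in> {1..r} \<Longrightarrow> - int (n j) \<le> k \<Longrightarrow> k \<le> int (n i) \<Longrightarrow> i \<noteq> j \<or> k \<noteq> 0 \<Longrightarrow>
      theta p (x i / x j * q powi (2 * k)) \<noteq> 0"
  using assms unfolding generic_params_def by meson+

lemma Delta_nonzero:
  assumes "\<And>i. i \<in> {1..r} \<Longrightarrow> x i \<noteq> 0"
    and "\<And>i j. i \<in> {1..r} \<Longrightarrow> j \<in> {1..r} \<Longrightarrow> i \<noteq> j \<Longrightarrow> theta p (x i / x j) \<noteq> 0"
  shows "Delta r p x \<noteq> 0"
proof -
  have "finite {(i, j). 1 \<le> i \<and> i < j \<and> j \<le> r}"
    by (rule finite_subset[of _ "{1..r} \<times> {1..r}"]) auto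
  then show ?thesis
    using assms by (auto simp: Delta_def)
qed

lemma Delta_cong:
  assumes "\<And>i. i \<in> {1..r} \<Longrightarrow> x i = y i"
  shows "Delta r p x = Delta r p y"
  unfolding Delta_def using assms by (intro prod.cong) auto

context
  fixes p q c d :: complex and r :: nat
  assumes p: "norm p < 1" and q: "q \<noteq> 0" and c: "c \<noteq> 0" and d: "d \<noteq> 0"
begin

text \<open>The shift changes each tested expression by a power of q only. The bounded window of
  exponents for x_i / x_j moves by bump_i - bump_j, and as (n - bump) + bump = n it stays inside the
  old one.\<close>

lemma generic_bump:
  assumes "generic_params p q r c a x n" "i0 \<in> {1..r}" "m \<le> n i0"
  shows "generic_params p q r c (a * q ^ m) (\<lambda>i. x i * q ^ (2 * bump i0 m i)) (\<lambda>i. n i - bump i0 m i)"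
proof -
  have 1: "a * q ^ m * (x i * q ^ (2 * bump i0 m i)) * q powi k = a * x i * q powi (k + int (m + 2 * bump i0 m i))" for i k
    using q by (simp only: power_int_add[OF disjI1[OF q]] power_int_of_nat power_add mult_ac)
  have 2: "(a * q ^ m)\<^sup>2 * (x i * q ^ (2 * bump i0 m i)) * (x j * q ^ (2 * bump i0 m j)) * q powi k
      = a\<^sup>2 * x i * x j * q powi (k + int (m + m + 2 * bump i0 m i + 2 * bump i0 m j))" for i j k
    unfolding power2_eq_square
    using q by (simp only: power_int_add[OF disjI1[OF q]] power_int_of_nat power_add mult_ac)
  have 3: "a * q ^ m / c * q powi k = a / c * q powi (k + int m)" for k
    using q by (simp add: power_int_add)
  have 4: "x i * q ^ (2 * bump i0 m i) / (x j * q ^ (2 * bump i0 m j)) * q powi (2 * k)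
      = x i / x j * q powi (2 * (k + int (bump i0 m i) - int (bump i0 m j)))" for i j k
  proof -
    have "2 * (k + int (bump i0 m i) - int (bump i0 m j)) = 2 * k + int (2 * bump i0 m i) - int (2 * bump i0 m j)"
      by simp
    then show ?thesis
      using q by (simp only: power_int_add[OF disjI1[OF q]] power_int_diff[OF disjI1[OF q]] power_int_of_nat) simp
  qed
  have "theta p (x i / x j * q powi (2 * (k + int (bump i0 m i) - int (bump i0 m j)))) \<noteq> 0"
    if "i \<in> {1..r}" "j \<in> {1..r}" "- int (n j - bump i0 m j) \<le> k" "k \<le> int (n i - bump i0 m i)" "i \<noteq> j \<or> k \<noteq> 0" for i j k
  proof -
    have "bump i0 m i \<le> n i" "bump i0 m j \<le> n j"
      using assms by (simp_all add: bump_def)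
    then have "- int (n j) \<le> k + int (bump i0 m i) - int (bump i0 m j)"
        "k + int (bump i0 m i) - int (bump i0 m j) \<le> int (n i)"
        "i \<noteq> j \<or> k + int (bump i0 m i) - int (bump i0 m j) \<noteq> 0"
      using that by (auto simp: of_nat_diff)
    then show ?thesis
      by (rule generic_paramsD(5)[OF assms(1) that(1,2)])
  qed
  then show ?thesis
    unfolding generic_params_def 1 2 3 4
    using q generic_paramsD(1-4)[OF assms(1)] by (intro conjI ballI allI impI) auto
qed

text \<open>The factors in b and q / b give |k| pairs, and those in a b x_i q and a x_i q^2 / b
  match up into n_i - k_i pairs for each i. The total is N for every k.\<close>

lemma bnum_theta_form:
  assumes "a \<noteq> 0" "\<And>i. i \<in> {1..r} \<Longrightarrow> x i \<noteq> 0" "\<And>i. i \<in> {1..r} \<Longrightarrow> k i \<le> n i"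
  shows "theta_form p q (weight r n) (bnum p q r a x n k)"
proof -
  have "theta_form p q (0 + weight r k) (\<lambda>b. 1 * (efac q p (1 * b) (weight r k) * efac q p (1 * q / b) (weight r k)))"
    by (intro theta_form_efac[OF p q] theta_form.const[OF p q]) (use q in auto)
  then have "theta_form p q (weight r k) (\<lambda>b. efac q p b (weight r k) * efac q p (q / b) (weight r k))"
    by simp
  then have "theta_form p q (weight r k + (\<Sum>i=1..r. n i - k i))
    (\<lambda>b. efac q p b (weight r k) * efac q p (q / b) (weight r k) * (\<Prod>i=1..r.
      efac (q\<^sup>2) p (a * x i * q * q ^ (2 * k i) * b) (n i - k i) * efac (q\<^sup>2) p (a * x i * q * q ^ (2 * k i) * q / b) (n i - k i)))"
    using assms q by (intro theta_form_prod_efac[OF p q]) auto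
  moreover have "weight r k + (\<Sum>i=1..r. n i - k i) = weight r n"
    unfolding weight_def sum.distrib[symmetric] using assms(3) by (intro sum.cong) auto
  moreover have "(\<lambda>b. efac q p b (weight r k) * efac q p (q / b) (weight r k) * (\<Prod>i=1..r.
      efac (q\<^sup>2) p (a * x i * q * q ^ (2 * k i) * b) (n i - k i) * efac (q\<^sup>2) p (a * x i * q * q ^ (2 * k i) * q / b) (n i - k i)))
      = bnum p q r a x n k"
    by (intro ext) (simp add: bnum_def[OF p q c d] power2_eq_square mult_ac)
  ultimately show ?thesis by simp
qed

lemma numer_theta_form:
  assumes "a \<noteq> 0"
  shows "theta_form p q (weight r n) (numer p q c r a x n)"
proof -
  define K where "K = (\<Prod>i=1..r. efac q p (a * x i * q) (2 * n i)) / efac q p (a * q / c) (2 * weight r n)"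
  have "theta_form p q (0 + weight r n) (\<lambda>b. K * (efac (q\<^sup>2) p (a * q / c * b) (weight r n)
      * efac (q\<^sup>2) p (a * q / c * q / b) (weight r n)))"
    by (intro theta_form_efac[OF p q] theta_form.const[OF p q]) (use assms q c in auto)
  moreover have "(\<lambda>b. K * (efac (q\<^sup>2) p (a * q / c * b) (weight r n) * efac (q\<^sup>2) p (a * q / c * q / b) (weight r n)))
      = numer p q c r a x n"
    by (intro ext) (simp add: numer_def[OF p q c d] K_def power2_eq_square mult_ac)
  ultimately show ?thesis by simp
qed

end

section \<open>The generic identity\<close>

context
  fixes p q c d :: complex and r :: nat
  assumes p: "norm p < 1" and q: "q \<noteq> 0" and c: "c \<noteq> 0" and d: "d \<noteq> 0"
begin

text \<open>At b = 1 the factorials in base q^2 interleave: those from a x_i q and a x_i q^2 form (a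
  x_i q; q, p)_(2 n_i), and those from a q / c and a q^2 / c cancel the denominator of
  \<open>numer\<close>.\<close>

lemma value_at_one:
  assumes gen: "generic_params p q r c a x n"
  shows "(\<Sum>k\<in>(\<Pi>\<^sub>E i\<in>{1..r}. {0..n i}). coef p q c d r a x n k * bnum p q r a x n k 1) = numer p q c r a x n 1"
proof -
  note gen = generic_paramsD[OF gen]
  \<comment> \<open>The zero vector as an element of the index set, hence \<open>undefined\<close>
    outside {1..r}.\<close>
  define k0 where "k0 = (\<lambda>i\<in>{1..r}. 0 :: nat)"
  have k0: "k0 i = 0" if "i \<in> {1..r}" for i using that by (simp add: k0_def)
  have W0: "weight r k0 = 0" by (simp add: weight_def k0)
  let ?K = "\<Pi>\<^sub>E i\<in>{1..r}. {0..n i}"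
  have "finite ?K" by (intro finite_PiE) auto
  have zero: "bnum p q r a x n k 1 = 0" if "k \<in> ?K - {k0}" for k
  proof -
    have "weight r k \<noteq> 0"
    proof
      assume "weight r k = 0"
      then have "k i = 0" if "i \<in> {1..r}" for i
        using that by (simp add: weight_def)
      then have "k = k0"
        using that by (intro ext) (auto simp: k0_def PiE_def extensional_def)
      then show False using that by simp
    qed
    then show ?thesis
      by (cases "weight r k") (simp_all add: bnum_def[OF p q c d] efac_Suc_shift p)
  qed
  have "(\<Sum>k\<in>?K. coef p q c d r a x n k * bnum p q r a x n k 1)
      = (\<Sum>k\<in>{k0}. coef p q c d r a x n k * bnum p q r a x n k 1)"
    using \<open>finite ?K\<close> zero by (intro sum.mono_neutral_right) (auto simp: k0_def)
  also have "\<dots> = coef p q c d r a x n k0 * bnum p q r a x n k0 1" by simp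
  also have "coef p q c d r a x n k0 = 1"
  proof -
    have "Delta r p x \<noteq> 0"
    proof (rule Delta_nonzero)
      fix i j assume "i \<in> {1..r}" "j \<in> {1..r}" "i \<noteq> j"
      then show "theta p (x i / x j) \<noteq> 0"
        using gen(5)[of i j 0] by simp
    qed (rule gen(1))
    moreover have "Delta r p (\<lambda>i. x i * q ^ (2 * k0 i)) = Delta r p x"
      by (rule Delta_cong) (simp add: k0)
    moreover have "theta p (a * x i) \<noteq> 0" if "i \<in> {1..r}" for i
      using gen(2)[OF that, of 0] by simp
    ultimately show ?thesis
      by (simp add: coef_def[OF p q c d] W0 k0)
  qed
  also have "bnum p q r a x n k0 1 = (\<Prod>i=1..r. efac q p (a * x i * q) (2 * n i))"
  proof -
    have "efac (q\<^sup>2) p (a * x i * q\<^sup>2 / 1 * q ^ (2 * k0 i)) (n i - k0 i) * efac (q\<^sup>2) p (a * 1 * x i * q * q ^ (2 * k0 i)) (n i - k0 i)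
      = efac q p (a * x i * q) (2 * n i)" if "i \<in> {1..r}" for i
      using efac_double[of q p "a * x i * q" "n i"] that by (simp add: k0 power2_eq_square mult_ac)
    then show ?thesis
      unfolding bnum_def[OF p q c d] W0 efac_0 mult_1_left by (intro prod.cong refl)
  qed
  also have "\<dots> = numer p q c r a x n 1"
  proof -
    have ne: "efac q p (a * q / c) (2 * weight r n) \<noteq> 0"
      using theta_generic_efac(1)[OF p q gen(4), of 1 "2 * weight r n"] by simp
    have eq: "efac (q\<^sup>2) p (a * q\<^sup>2 / (1 * c)) (weight r n) * efac (q\<^sup>2) p (a * 1 * q / c) (weight r n)
        = efac q p (a * q / c) (2 * weight r n)"
      using efac_double[of q p "a * q / c" "weight r n"] by (simp add: power2_eq_square mult_ac)
    show ?thesis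
      unfolding numer_def[OF p q c d] eq using ne by simp
  qed
  finally show ?thesis by simp
qed

lemma bnum_vanishes:
  assumes "a \<noteq> 0" "x i0 \<noteq> 0" "i0 \<in> {1..r}" "k i0 < m" "m \<le> n i0"
  shows "bnum p q r a x n k (a * x i0 * q ^ (2 * m)) = 0"
proof -
  \<comment> \<open>The run starts at q^(2(k_i0 + 1 - m)), so its factor number m - 1 - k_i0 is
    theta(1); m \<le> n_i0 keeps this below the length n_i0 - k_i0.\<close>
  have "a * x i0 * q\<^sup>2 / (a * x i0 * q ^ (2 * m)) * q ^ (2 * k i0) * (q\<^sup>2) ^ (m - Suc (k i0)) = 1"
  proof -
    have "q ^ (2 * m) = q\<^sup>2 * (q ^ (2 * k i0) * (q\<^sup>2) ^ (m - Suc (k i0)))"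
    proof -
      have "2 * m = 2 + (2 * k i0 + 2 * (m - Suc (k i0)))" using assms(4) by simp
      then show ?thesis by (simp only: power_add power_mult)
    qed
    then show ?thesis using assms q by (simp add: mult.assoc)
  qed
  then have "efac (q\<^sup>2) p (a * x i0 * q\<^sup>2 / (a * x i0 * q ^ (2 * m)) * q ^ (2 * k i0)) (n i0 - k i0) = 0"
    unfolding efac_eq_0_iff using assms by (intro exI[of _ "m - Suc (k i0)"]) (auto simp: p)
  then have "\<exists>i\<in>{1..r}. efac (q\<^sup>2) p (a * x i * q\<^sup>2 / (a * x i0 * q ^ (2 * m)) * q ^ (2 * k i)) (n i - k i) = 0"
    using assms(3) by blast
  then show ?thesis
    unfolding bnum_def[OF p q c d] by (simp only: mult_eq_0_iff prod_zero_iff[OF finite_atLeastAtMost]) blast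
qed

text \<open>The exponents of q run through 2(s - t + h) for h < l; the bounds keep s - t + h in the
  window of \<open>generic_params\<close>, and for i = j the condition s > t avoids
  theta(1).\<close>

lemma ratio_nonzero:
  assumes gen: "generic_params p q r c a x n" and ij: "i \<in> {1..r}" "j \<in> {1..r}"
    and t: "int s - int t \<ge> - int (n j)" "int s - int t + int l \<le> int (n i) + 1" "i \<noteq> j \<or> s > t"
  shows "efac (q\<^sup>2) p (x i * q ^ (2 * s) / (x j * q ^ (2 * t))) l \<noteq> 0"
proof -
  have "theta p (x i * q ^ (2 * s) / (x j * q ^ (2 * t)) * (q\<^sup>2) ^ h) \<noteq> 0" if "h < l" for h
  proof -
    have "2 * (int s - int t + int h) = int (2 * s + 2 * h) - int (2 * t)" by simp
    then have "q powi (2 * (int s - int t + int h)) = q ^ (2 * s) * (q\<^sup>2) ^ h / q ^ (2 * t)"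
      by (simp only: power_int_diff[OF disjI1[OF q]] power_int_of_nat power_add power_mult)
    then have "x i * q ^ (2 * s) / (x j * q ^ (2 * t)) * (q\<^sup>2) ^ h = x i / x j * q powi (2 * (int s - int t + int h))"
      by simp
    moreover have "theta p (x i / x j * q powi (2 * (int s - int t + int h))) \<noteq> 0"
      by (rule generic_paramsD(5)[OF gen ij]) (use t that in auto)
    ultimately show ?thesis by simp
  qed
  then show ?thesis unfolding efac_eq_0_iff by blast
qed

text \<open>The induction hypothesis is taken as an implication because its premise, that the
  \<open>b\<close>-denominator at the new parameters is nonzero, is established inside this
  proof.\<close>

lemma value_at_shift:
  assumes gen: "generic_params p q r c a x n" and a: "a \<noteq> 0"
    and i0: "i0 \<in> {1..r}" and m: "1 \<le> m" "m \<le> n i0"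
    and bal: "a\<^sup>2 * q ^ (2 * weight r n + 1) = c * d"
    and IH: "bden p q r (a * q ^ m) (\<lambda>i. x i * q ^ (2 * bump i0 m i)) (\<lambda>i. n i - bump i0 m i) (a * x i0 * q ^ m) \<noteq> 0 \<Longrightarrow>
      (\<Sum>k\<in>(\<Pi>\<^sub>E i\<in>{1..r}. {0..n i - bump i0 m i}). summand p q r c d (a * q ^ m) (a * x i0 * q ^ m)
        (\<lambda>i. x i * q ^ (2 * bump i0 m i)) (\<lambda>i. n i - bump i0 m i) k)
      = closed_form p q r c (a * q ^ m) (a * x i0 * q ^ m) (\<lambda>i. x i * q ^ (2 * bump i0 m i)) (\<lambda>i. n i - bump i0 m i)"
  shows "(\<Sum>k\<in>(\<Pi>\<^sub>E i\<in>{1..r}. {0..n i}). coef p q c d r a x n k * bnum p q r a x n k (a * x i0 * q ^ (2 * m)))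
    = numer p q c r a x n (a * x i0 * q ^ (2 * m))"
proof -
  define a' where "a' = a * q ^ m"
  define x' where "x' = (\<lambda>i. x i * q ^ (2 * bump i0 m i))"
  define n' where "n' = (\<lambda>i. n i - bump i0 m i)"
  define b' where "b' = a * x i0 * q ^ m"
  define b0 where "b0 = a * x i0 * q ^ (2 * m)"
  note g = generic_paramsD[OF gen]
  have gen': "generic_params p q r c a' x' n'"
    unfolding a'_def x'_def n'_def by (rule generic_bump[OF p q c d gen i0 m(2)])
  note g' = generic_paramsD[OF gen']
  have x0: "x i0 \<noteq> 0" using g(1) i0 .
  have le: "bump i0 m i \<le> n i" for i using m by (simp add: bump_def)
  have mm: "q ^ (2 * m) = q ^ m * q ^ m" by (simp add: mult_2 power_add)
  have D': "Delta r p x' \<noteq> 0"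
  proof (rule Delta_nonzero)
    fix i j assume "i \<in> {1..r}" "j \<in> {1..r}" "i \<noteq> j"
    then show "theta p (x' i / x' j) \<noteq> 0"
      using g'(5)[of i j 0] by simp
  qed (rule g'(1))
  have D: "Delta r p x \<noteq> 0"
  proof (rule Delta_nonzero)
    fix i j assume "i \<in> {1..r}" "j \<in> {1..r}" "i \<noteq> j"
    then show "theta p (x i / x j) \<noteq> 0"
      using g(5)[of i j 0] by simp
  qed (rule g(1))
  have th': "(\<Prod>i=1..r. theta p (a' * x' i)) \<noteq> 0"
    using g'(2)[of _ 0] by simp
  \<comment> \<open>The argument is q^2 x'_i / x_i0, free of \<open>a\<close>, so only the bounded
    window can be used; the last exponent is exactly 2 n_i.\<close>
  have BR1: "efac (q\<^sup>2) p (a' * x' i * q\<^sup>2 / b') (n' i) \<noteq> 0" if i: "i \<in> {1..r}" for i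
  proof -
    have "efac (q\<^sup>2) p (x i * q ^ (2 * (bump i0 m i + 1)) / (x i0 * q ^ (2 * 0))) (n' i) \<noteq> 0"
      by (rule ratio_nonzero[OF gen i i0]) (use le[of i] in \<open>auto simp: n'_def of_nat_diff\<close>)
    moreover have "x i * q ^ (2 * (bump i0 m i + 1)) / (x i0 * q ^ (2 * 0)) = a' * x' i * q\<^sup>2 / b'"
      unfolding a'_def x'_def b'_def using a x0 q by (simp add: field_simps power2_eq_square)
    ultimately show ?thesis by simp
  qed
  have BR2: "efac (q\<^sup>2) p (a' * b' * x' i * q) (n' i) \<noteq> 0" if i: "i \<in> {1..r}" for i
  proof -
    have "a' * b' * x' i * q = a\<^sup>2 * x i * x i0 * q ^ (m + m + 2 * bump i0 m i + 1)"
      unfolding a'_def x'_def b'_def power_add power2_eq_square by (simp add: mult_ac)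
    then show ?thesis
      by (simp only: theta_generic_efac(2)[OF p q g(3)[OF i i0]] not_False_eq_True)
  qed
  have bden': "bden p q r a' x' n' b' \<noteq> 0"
    unfolding bden_def[OF p q c d] using BR1 BR2 by simp
  have BR: "(\<Prod>i=1..r. efac (q\<^sup>2) p (a * x i * q\<^sup>2 / b0 * q ^ (2 * bump i0 m i)) (n' i)) \<noteq> 0"
  proof -
    have "efac (q\<^sup>2) p (a * x i * q\<^sup>2 / b0 * q ^ (2 * bump i0 m i)) (n' i) \<noteq> 0" if i: "i \<in> {1..r}" for i
    proof -
      have "efac (q\<^sup>2) p (x i * q ^ (2 * (bump i0 m i + 1)) / (x i0 * q ^ (2 * m))) (n' i) \<noteq> 0"
        by (rule ratio_nonzero[OF gen i i0]) (use le[of i] m in \<open>auto simp: n'_def of_nat_diff bump_def\<close>)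
      moreover have "x i * q ^ (2 * (bump i0 m i + 1)) / (x i0 * q ^ (2 * m)) = a * x i * q\<^sup>2 / b0 * q ^ (2 * bump i0 m i)"
        unfolding b0_def using a x0 q by (simp add: field_simps power2_eq_square)
      ultimately show ?thesis by simp
    qed
    then show ?thesis by simp
  qed
  have ac: "efac q p (a * q / c) l \<noteq> 0" for l
    using theta_generic_efac(1)[OF p q g(4), of 1 l] by simp
  \<comment> \<open>Balancing gives a q / d = c / (a q^(2N)), so theta inversion reduces this to the
    condition on a / c.\<close>
  have ad: "efac q p (a * q / d) l \<noteq> 0" for l
  proof -
    have "theta p (a * q / d * q ^ j) \<noteq> 0" for j
    proof -
      have "a / c * q powi (int (2 * weight r n) - int j) = a / c * (q ^ (2 * weight r n) / q ^ j)"
        by (simp only: power_int_diff[OF disjI1[OF q]] power_int_of_nat)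
      then have ne: "theta p (a * q ^ (2 * weight r n) / (c * q ^ j)) \<noteq> 0"
        using g(4)[of "int (2 * weight r n) - int j"] by simp
      have d_eq: "d = a\<^sup>2 * q ^ (2 * weight r n + 1) / c"
        using bal c by (simp add: field_simps)
      have "a * q / d * q ^ j = c * q ^ j / (a * q ^ (2 * weight r n))"
        unfolding d_eq using a q c by (simp add: field_simps power2_eq_square)
      then show ?thesis
        using ne theta_swap_eq_0_iff[OF p, of "c * q ^ j" "a * q ^ (2 * weight r n)"] a c q by simp
    qed
    then show ?thesis unfolding efac_eq_0_iff by blast
  qed
  have lead: "coef p q c d r a x n (bump i0 m) * bnum p q r a x n (bump i0 m) b0 * closed_form p q r c a' b' x' n'
    = numer p q c r a x n b0"
    unfolding a'_def x'_def n'_def b'_def b0_def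
  proof (rule leading_term[where a = a and x = x and n = n and m = m, OF p q c d a g(1) i0 m(2) bal D ac ad _ _ _ _ _ bden'[unfolded a'_def x'_def n'_def b'_def]])
    fix i assume i: "i \<in> {1..r}"
    show "theta p (a * x i) \<noteq> 0" using g(2)[OF i, of 0] by simp
    show "efac q p (a * x i * q ^ (2 * n i + 1)) m \<noteq> 0"
      by (rule theta_generic_efac(1)[OF p q g(2)[OF i]])
    show "efac (q\<^sup>2) p (q\<^sup>2 * x i0 / x i) m \<noteq> 0"
      using ratio_nonzero[OF gen i0 i, of 1 0 m] m by (simp add: mult.commute)
  next
    fix j assume j: "j \<in> {1..r} - {i0}"
    then show "theta p (x i0 / x j) \<noteq> 0" using g(5)[of i0 j 0] i0 by simp
    have "q powi (2 * int m) = (q\<^sup>2) ^ m"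
    proof -
      have "2 * int m = int (2 * m)" by simp
      then show ?thesis by (simp only: power_int_of_nat power_mult)
    qed
    then show "theta p ((q\<^sup>2) ^ m * (x i0 / x j)) \<noteq> 0"
      using g(5)[of i0 j "int m"] i0 j m by (simp add: mult.commute)
  qed
  let ?K = "\<Pi>\<^sub>E i\<in>{1..r}. {0..n i}"
  let ?K' = "\<Pi>\<^sub>E i\<in>{1..r}. {0..n' i}"
  have "finite ?K" by (intro finite_PiE) auto
  have "(\<Sum>k\<in>?K. coef p q c d r a x n k * bnum p q r a x n k b0)
    = (\<Sum>k\<in>{k \<in> ?K. m \<le> k i0}. coef p q c d r a x n k * bnum p q r a x n k b0)"
  proof (intro sum.mono_neutral_right ballI)
    fix k assume "k \<in> ?K - {k \<in> ?K. m \<le> k i0}"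
    then have "k i0 < m" by auto
    then show "coef p q c d r a x n k * bnum p q r a x n k b0 = 0"
      unfolding b0_def using bnum_vanishes[of a x i0 k m n, OF a x0 i0 _ m(2)] by simp
  qed (use \<open>finite ?K\<close> in auto)
  \<comment> \<open>\<open>bump\<close> is 0 outside {1..r}, so the shift keeps the value
    \<open>undefined\<close> there and maps one extensional index set onto the other.\<close>
  also have "\<dots> = (\<Sum>k\<in>?K'. coef p q c d r a x n (\<lambda>i. k i + bump i0 m i) * bnum p q r a x n (\<lambda>i. k i + bump i0 m i) b0)"
  proof (rule sum.reindex_bij_witness[of _ "\<lambda>k i. k i + bump i0 m i" "\<lambda>k i. k i - bump i0 m i"])
    fix k assume k: "k \<in> {k \<in> ?K. m \<le> k i0}"
    show eq: "(\<lambda>i. k i - bump i0 m i + bump i0 m i) = k"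
      using k by (auto simp: bump_def fun_eq_iff)
    show "(\<lambda>i. k i - bump i0 m i) \<in> ?K'"
    proof (rule PiE_I)
      fix i assume "i \<in> {1..r}"
      then have "k i \<le> n i" using k by (auto dest: PiE_mem)
      then show "k i - bump i0 m i \<in> {0..n' i}" by (simp add: n'_def diff_le_mono)
    next
      fix i assume i: "i \<notin> {1..r}"
      then have "i \<noteq> i0" using i0 by metis
      moreover have "k i = undefined" using k PiE_arb[of k "{1..r}" _ i, OF _ i] by blast
      ultimately show "k i - bump i0 m i = undefined" by (simp add: bump_def)
    qed
    show "coef p q c d r a x n (\<lambda>i. k i - bump i0 m i + bump i0 m i) * bnum p q r a x n (\<lambda>i. k i - bump i0 m i + bump i0 m i) b0
        = coef p q c d r a x n k * bnum p q r a x n k b0"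
      unfolding eq ..
  next
    fix k assume k: "k \<in> ?K'"
    show "(\<lambda>i. k i + bump i0 m i - bump i0 m i) = k" by simp
    have "(\<lambda>i. k i + bump i0 m i) \<in> ?K"
    proof (rule PiE_I)
      fix i assume "i \<in> {1..r}"
      then have "k i \<le> n' i" using k by (auto dest: PiE_mem)
      then show "k i + bump i0 m i \<in> {0..n i}" using le[of i] by (simp add: n'_def)
    next
      fix i assume i: "i \<notin> {1..r}"
      then have "i \<noteq> i0" using i0 by metis
      moreover have "k i = undefined" by (rule PiE_arb[OF k i])
      ultimately show "k i + bump i0 m i = undefined" by (simp add: bump_def)
    qed
    then show "(\<lambda>i. k i + bump i0 m i) \<in> {k \<in> ?K. m \<le> k i0}" by (simp add: bump_def)
  qed
  also have "\<dots> = (\<Sum>k\<in>?K'. coef p q c d r a x n (bump i0 m) * bnum p q r a x n (bump i0 m) b0 * summand p q r c d a' b' x' n' k)"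
  proof (rule sum.cong[OF refl])
    fix k assume k: "k \<in> ?K'"
    show "coef p q c d r a x n (\<lambda>i. k i + bump i0 m i) * bnum p q r a x n (\<lambda>i. k i + bump i0 m i) b0
      = coef p q c d r a x n (bump i0 m) * bnum p q r a x n (bump i0 m) b0 * summand p q r c d a' b' x' n' k"
      unfolding a'_def x'_def n'_def b'_def b0_def
    proof (rule term_shift[where a = a and x = x and n = n and m = m, OF p q c d a g(1) i0 m(2)])
      fix i assume "i \<in> {1..r}"
      then show "k i \<le> n i - bump i0 m i"
        using k by (auto simp: n'_def dest: PiE_mem)
    qed (use D' th' bden' BR in \<open>simp_all only: a'_def x'_def n'_def b'_def b0_def not_False_eq_True\<close>)
  qed
  also have "\<dots> = coef p q c d r a x n (bump i0 m) * bnum p q r a x n (bump i0 m) b0 * closed_form p q r c a' b' x' n'"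
    using IH[folded a'_def x'_def b'_def, folded n'_def, OF bden'] by (simp add: n'_def flip: sum_distrib_left)
  finally show ?thesis unfolding lead unfolding b0_def .
qed

text \<open>The pair is theta(\<beta> t / \<beta> s) theta(q / (\<beta> s \<beta> t)). Up to
  inversion, and up to powers of q, the arguments are x_i / x_j and a^2 x_i x_j for two points other
  than 1, and a x_i against the point 1. The first three families of conditions on theta in
  \<open>generic_params\<close> other than a / c have this origin.\<close>

lemma points_independent:
  assumes gen: "generic_params p q r c a x n" and a: "a \<noteq> 0"
    and qp: "\<And>k m. k > (0 :: nat) \<Longrightarrow> q ^ k \<noteq> p powi m"
    and \<beta>: "\<beta> = (\<lambda>(i, m). if i = 0 then 1 else a * x i * q ^ (2 * m))"
    and J: "J = insert (0, 0) (SIGMA i:{1..r}. {1..n i})"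
    and st: "s \<in> J" "t \<in> J" "s \<noteq> t"
  shows "pair p q (1 / \<beta> s) (\<beta> t) \<noteq> 0"
proof -
  note g = generic_paramsD[OF gen]
  have nz: "\<beta> s \<noteq> 0" if "s \<in> J" for s
    using that g(1) a q by (auto simp: \<beta> J)
  have single: "theta p (\<beta> (j, l)) \<noteq> 0" "theta p (\<beta> (j, l) / q) \<noteq> 0" if "j \<in> {1..r}" for j l
  proof -
    have \<beta>': "\<beta> (j, l) = a * x j * q ^ (2 * l)" using that by (simp add: \<beta>)
    then have "\<beta> (j, l) = a * x j * q powi int (2 * l)" by (simp only: power_int_of_nat)
    then show "theta p (\<beta> (j, l)) \<noteq> 0" using g(2)[OF that] by metis
    have "\<beta> (j, l) / q = a * x j * q powi (int (2 * l) - 1)"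
      unfolding \<beta>' by (simp only: power_int_diff[OF disjI1[OF q]] power_int_of_nat power_int_1_right times_divide_eq_right)
    then show "theta p (\<beta> (j, l) / q) \<noteq> 0" using g(2)[OF that] by metis
  qed
  have double: "theta p (\<beta> (i, m) / \<beta> (j, l)) \<noteq> 0" "theta p (\<beta> (i, m) * \<beta> (j, l) / q) \<noteq> 0"
    if "i \<in> {1..r}" "j \<in> {1..r}" "m \<in> {1..n i}" "l \<in> {1..n j}" "(i, m) \<noteq> (j, l)" for i j m l
  proof -
    have \<beta>': "\<beta> (i, m) = a * x i * q ^ (2 * m)" "\<beta> (j, l) = a * x j * q ^ (2 * l)"
      using that by (simp_all add: \<beta>)
    have "2 * (int m - int l) = int (2 * m) - int (2 * l)" by simp
    then have "q powi (2 * (int m - int l)) = q ^ (2 * m) / q ^ (2 * l)"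
      by (simp only: power_int_diff[OF disjI1[OF q]] power_int_of_nat)
    then have "\<beta> (i, m) / \<beta> (j, l) = x i / x j * q powi (2 * (int m - int l))"
      unfolding \<beta>' using a by simp
    moreover have "theta p (x i / x j * q powi (2 * (int m - int l))) \<noteq> 0"
      by (rule g(5)) (use that in auto)
    ultimately show "theta p (\<beta> (i, m) / \<beta> (j, l)) \<noteq> 0" by simp
    have "\<beta> (i, m) * \<beta> (j, l) / q = a\<^sup>2 * x i * x j * (q ^ (2 * m) * q ^ (2 * l) / q)"
      unfolding \<beta>' by (simp add: power2_eq_square)
    also have "\<dots> = a\<^sup>2 * x i * x j * q powi (int (2 * m) + int (2 * l) - 1)"
      by (simp only: power_int_diff[OF disjI1[OF q]] power_int_add[OF disjI1[OF q]] power_int_of_nat power_int_1_right)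
    finally show "theta p (\<beta> (i, m) * \<beta> (j, l) / q) \<noteq> 0"
      using g(3)[OF that(1,2)] by metis
  qed
  have "theta p (\<beta> t / \<beta> s) \<noteq> 0 \<and> theta p (\<beta> s * \<beta> t / q) \<noteq> 0"
  proof -
    obtain i m j l where st': "s = (i, m)" "t = (j, l)" by fastforce
    have one: "\<beta> (0, 0) = 1" by (simp add: \<beta>)
    consider "s = (0, 0)" "j \<in> {1..r}" | "t = (0, 0)" "i \<in> {1..r}"
      | "i \<in> {1..r}" "j \<in> {1..r}" "m \<in> {1..n i}" "l \<in> {1..n j}"
      using st unfolding st' J by auto
    then show ?thesis
    proof cases
      case 1
      then show ?thesis using single[of j l] by (simp add: st' one)
    next
      case 2
      then show ?thesis
        using single[of i m] nz[OF st(1)] theta_swap_eq_0_iff[OF p, of "\<beta> s" 1] by (simp add: st' one)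
    next
      case 3
      then show ?thesis using double(1)[of j i l m] double(2)[of i j m l] st(3) by (auto simp: st')
    qed
  qed
  moreover have "theta p (q / (\<beta> s * \<beta> t)) = 0 \<longleftrightarrow> theta p (\<beta> s * \<beta> t / q) = 0"
    using nz st q by (intro theta_swap_eq_0_iff[OF p]) auto
  ultimately show ?thesis by (simp add: pair_def)
qed

text \<open>The induction is strong because m may be anything up to n_i. It has no separate base
  case: for N = 0 the numerator difference is constant and the point b = 1 suffices.\<close>

lemma identity_generic:
  assumes qp: "\<And>k m. k > (0 :: nat) \<Longrightarrow> q ^ k \<noteq> p powi m"
    and "generic_params p q r c a x n" and "a \<noteq> 0" "b \<noteq> 0"
    and "a\<^sup>2 * q ^ (2 * weight r n + 1) = c * d" and "bden p q r a x n b \<noteq> 0"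
  shows "(\<Sum>k\<in>(\<Pi>\<^sub>E i\<in>{1..r}. {0..n i}). summand p q r c d a b x n k) = closed_form p q r c a b x n"
  using assms(2-6)
proof (induction "weight r n" arbitrary: a b x n rule: less_induct)
  case less
  note gen = less.prems(1) and a = less.prems(2) and b = less.prems(3) and bal = less.prems(4) and bden = less.prems(5)
  note g = generic_paramsD[OF gen]
  let ?K = "\<Pi>\<^sub>E i\<in>{1..r}. {0..n i}"
  define f where "f = (\<lambda>b. (\<Sum>k\<in>?K. coef p q c d r a x n k * bnum p q r a x n k b) + (- 1) * numer p q c r a x n b)"
  \<comment> \<open>Index (0, 0) stands for b = 1. It is new because 0 is not in {1..r}, so
    \<open>card J\<close> is N + 1.\<close>
  define J where "J = insert (0, 0) (SIGMA i:{1..r}. {1..n i})"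
  define \<beta> where "\<beta> = (\<lambda>(i, m). if i = 0 then 1 else a * x i * q ^ (2 * m))"
  have form: "theta_form p q (weight r n) f"
    unfolding f_def
  proof (intro theta_form.add[OF p q] theta_form_sum[OF p q] theta_form_scale[OF p q])
    show "finite ?K" by (intro finite_PiE) auto
    show "?K \<noteq> {}" by (auto simp: PiE_eq_empty_iff)
    fix k assume "k \<in> ?K"
    then show "theta_form p q (weight r n) (bnum p q r a x n k)"
      by (intro bnum_theta_form[OF p q c d a g(1)]) (auto dest: PiE_mem)
  qed (rule numer_theta_form[OF p q c d a])
  have card: "card J = Suc (weight r n)"
    unfolding J_def weight_def by (subst card_insert_disjoint) auto
  have zero: "f (\<beta> s) = 0" if s: "s \<in> J" for s
  proof (cases "s = (0, 0)")
    case True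
    then show ?thesis
      using value_at_one[OF gen] by (simp add: f_def \<beta>_def)
  next
    case False
    then obtain i m where im: "s = (i, m)" "i \<in> {1..r}" "1 \<le> m" "m \<le> n i"
      using s by (auto simp: J_def)
    define a' where "a' = a * q ^ m"
    define x' where "x' = (\<lambda>j. x j * q ^ (2 * bump i m j))"
    define n' where "n' = (\<lambda>j. n j - bump i m j)"
    have "weight r n = weight r n' + m"
      unfolding n'_def by (rule weight_diff_bump[of i r m n, OF im(2) im(4)])
    \<comment> \<open>The exponent in the balancing condition drops by 2m, which the factor q^(2m)
      in a'^2 makes up for.\<close>
    then have W': "weight r n' < weight r n" "2 * weight r n + 1 = m + m + (2 * weight r n' + 1)"
      using im(3) by simp_all
    have "a'\<^sup>2 * q ^ (2 * weight r n' + 1) = c * d"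
      unfolding bal[symmetric] W'(2) power_add a'_def power2_eq_square by (simp only: mult_ac)
    moreover have "generic_params p q r c a' x' n'"
      unfolding a'_def x'_def n'_def by (rule generic_bump[OF p q c d gen im(2,4)])
    moreover have "a' \<noteq> 0" "a * x i * q ^ m \<noteq> 0"
      using a q g(1)[OF im(2)] by (simp_all add: a'_def)
    ultimately have IH: "bden p q r a' x' n' (a * x i * q ^ m) \<noteq> 0 \<Longrightarrow>
        (\<Sum>k\<in>(\<Pi>\<^sub>E j\<in>{1..r}. {0..n' j}). summand p q r c d a' (a * x i * q ^ m) x' n' k)
        = closed_form p q r c a' (a * x i * q ^ m) x' n'"
      using less.hyps[OF W'(1)] by blast
    have "\<beta> s = a * x i * q ^ (2 * m)" using im by (simp add: \<beta>_def)
    then show ?thesis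
      using value_at_shift[OF gen a im(2-4) bal IH[unfolded a'_def x'_def n'_def]] by (simp add: f_def)
  qed
  have "f b = 0"
  proof (rule theta_form_eq_0[OF p q form card _ _ _ b])
    show "\<beta> s \<noteq> 0" if "s \<in> J" for s
      using that g(1) a q by (auto simp: \<beta>_def J_def)
    show "pair p q (1 / \<beta> s) (\<beta> t) \<noteq> 0" if "s \<in> J" "t \<in> J" "s \<noteq> t" for s t
      by (rule points_independent[OF gen a qp \<beta>_def J_def that])
  qed (rule zero)
  then have "(\<Sum>k\<in>?K. coef p q c d r a x n k * bnum p q r a x n k b) = numer p q c r a x n b"
    by (simp add: f_def)
  moreover have "(\<Sum>k\<in>?K. summand p q r c d a b x n k)
      = (\<Sum>k\<in>?K. coef p q c d r a x n k * bnum p q r a x n k b / bden p q r a x n b)"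
    by (intro sum.cong refl summand_eq[OF p q c d _ bden]) (auto dest: PiE_mem)
  ultimately show ?case
    by (simp add: closed_form_eq[OF p q c d] flip: sum_divide_distrib)
qed

end

section \<open>Removing the genericity\<close>

lemma isCont_efac:
  assumes "norm p < 1" "q \<noteq> 0" "isCont f z" "f z \<noteq> 0"
  shows "isCont (\<lambda>z. efac q p (f z) k) z"
  unfolding efac_def using assms by (intro continuous_intros isCont_theta) auto

lemma countable_theta_scaled_zeros:
  assumes "norm p < 1" "w \<noteq> 0"
  shows "countable {z. theta p (z * w) = 0}" "countable {z. theta p (z\<^sup>2 * w) = 0}"
proof -
  have c: "countable {u. theta p u = 0}"
    by (rule countable_theta_zeros[OF assms(1)])
  have "{z. theta p (z * w) = 0} \<subseteq> (\<lambda>u. u / w) ` {u. theta p u = 0}"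
  proof
    fix z assume "z \<in> {z. theta p (z * w) = 0}"
    then show "z \<in> (\<lambda>u. u / w) ` {u. theta p u = 0}"
      using assms by (intro image_eqI[of _ _ "z * w"]) auto
  qed
  then show "countable {z. theta p (z * w) = 0}"
    using c countable_subset by blast
  have "{z. theta p (z\<^sup>2 * w) = 0} \<subseteq> (\<lambda>u. csqrt (u / w)) ` {u. theta p u = 0} \<union> (\<lambda>u. - csqrt (u / w)) ` {u. theta p u = 0}"
  proof
    fix z assume z: "z \<in> {z. theta p (z\<^sup>2 * w) = 0}"
    have "z = csqrt (z\<^sup>2) \<or> z = - csqrt (z\<^sup>2)"
      by (metis power2_csqrt power2_eq_iff)
    moreover have "z\<^sup>2 = z\<^sup>2 * w / w" using assms by simp
    ultimately show "z \<in> (\<lambda>u. csqrt (u / w)) ` {u. theta p u = 0} \<union> (\<lambda>u. - csqrt (u / w)) ` {u. theta p u = 0}"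
      using z by (metis (mono_tags, lifting) UnI1 UnI2 image_eqI mem_Collect_eq)
  qed
  then show "countable {z. theta p (z\<^sup>2 * w) = 0}"
    using c countable_subset by (metis countable_Un countable_image)
qed

lemma efac_nonzero_le: "efac q p z l \<noteq> 0 \<Longrightarrow> k \<le> l \<Longrightarrow> efac q p z k \<noteq> 0"
  by (auto simp: efac_eq_0_iff)

text \<open>For 1 \<le> k \<le> n_i the value is a factor of the denominator (q^2 x_i / x_j; q^2,
  p)_(n_i), and k = 0 comes from \<open>Delta\<close>. For negative k theta inversion exchanges i
  and j, whence the lower bound - n_j.\<close>

lemma ratio_generic:
  assumes p: "norm p < 1" and q: "q \<noteq> 0" and qp: "\<And>k m. k > (0 :: nat) \<Longrightarrow> q ^ k \<noteq> p powi m"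
    and x: "\<And>i. i \<in> {1..r} \<Longrightarrow> x i \<noteq> 0"
    and Delta: "Delta r p x \<noteq> 0"
    and xx: "\<And>i j. i \<in> {1..r} \<Longrightarrow> j \<in> {1..r} \<Longrightarrow> efac (q\<^sup>2) p (q\<^sup>2 * x i / x j) (n i) \<noteq> 0"
    and ij: "i \<in> {1..r}" "j \<in> {1..r}" "- int (n j) \<le> k" "k \<le> int (n i)" "i \<noteq> j \<or> k \<noteq> 0"
  shows "theta p (x i / x j * q powi (2 * k)) \<noteq> 0"
proof -
  have pos: "theta p (x i / x j * q ^ (2 * k)) \<noteq> 0" if "i \<in> {1..r}" "j \<in> {1..r}" "0 < k" "k \<le> n i" for i j k
  proof -
    have eq: "q\<^sup>2 * x i / x j * (q\<^sup>2) ^ (k - 1) = x i / x j * q ^ (2 * k)"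
    proof -
      have "2 * k = 2 + 2 * (k - 1)" using that by simp
      then have "q ^ (2 * k) = q\<^sup>2 * (q\<^sup>2) ^ (k - 1)" by (simp only: power_add power_mult)
      then show ?thesis by simp
    qed
    have "theta p (q\<^sup>2 * x i / x j * (q\<^sup>2) ^ (k - 1)) \<noteq> 0"
      using xx[OF that(1,2)] that unfolding efac_eq_0_iff by (metis diff_less less_le_trans less_one)
    then show ?thesis unfolding eq .
  qed
  have zero: "theta p (x i / x j) \<noteq> 0" if ij: "i \<in> {1..r}" "j \<in> {1..r}" "i \<noteq> j" for i j
  proof -
    have fin: "finite {(i, j). 1 \<le> i \<and> i < j \<and> j \<le> r}"
      by (rule finite_subset[of _ "{1..r} \<times> {1..r}"]) auto
    have "theta p (x i / x j) \<noteq> 0" if "1 \<le> i" "i < j" "j \<le> r" for i j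
      using Delta fin that unfolding Delta_def by auto
    then show ?thesis
      using ij theta_swap_eq_0_iff[OF p x[OF ij(1)] x[OF ij(2)]] by (cases "i < j") auto
  qed
  consider "k = 0" | l where "k = int l" "0 < l" | l where "k = - int l" "0 < l"
    by (metis int_cases2 of_nat_0_less_iff gr0I of_nat_0 minus_zero)
  then show ?thesis
  proof cases
    case 1
    then show ?thesis using zero ij by simp
  next
    case 2
    then have "q powi (2 * k) = q ^ (2 * l)"
      using power_int_of_nat[of q "2 * l"] by simp
    then show ?thesis using pos[of i j l] ij 2 by simp
  next
    case 3
    have "q powi (2 * k) = 1 / q ^ (2 * l)"
      using power_int_neg_double[of q l] 3 by simp
    then have "x i / x j * q powi (2 * k) = x i / (x j * q ^ (2 * l))" by simp
    moreover have "theta p (x j * q ^ (2 * l) / x i) \<noteq> 0"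
      using pos[of j i l] ij 3 by simp
    ultimately show ?thesis
      using theta_swap_eq_0_iff[OF p, of "x i" "x j * q ^ (2 * l)"] x ij q by simp
  qed
qed

theorem theorem4p5:
  fixes p q a b c d :: complex
    and r :: nat
    and n :: "nat \<Rightarrow> nat"
    and x :: "nat \<Rightarrow> complex"
  assumes p: "norm p < 1"
    and q: "q \<noteq> 0" "\<And>(k::nat) (m::int). k > 0 \<Longrightarrow> q ^ k \<noteq> p powi m"
    and r: "r \<ge> 1"
    and nonzero: "a \<noteq> 0" "b \<noteq> 0" "c \<noteq> 0" "d \<noteq> 0" "\<And>i. i \<in> {1..r} \<Longrightarrow> x i \<noteq> 0"
    and balancing: "a ^ 2 * q ^ (2 * weight r n + 1) = c * d"
    (* No denominator vanishes. A shifted factorial of length k divides the one of any length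
       l >= k, so it suffices to consider the largest lengths that occur. *)
    and generic_Delta: "Delta r p x \<noteq> 0"
    and generic_acd: "efacs q p [a * q / c, a * q / d] (weight r n) \<noteq> 0"
    and generic_ac: "efac q p (a * q / c) (2 * weight r n) \<noteq> 0"
    and generic_xx: "\<And>i j. i \<in> {1..r} \<Longrightarrow> j \<in> {1..r} \<Longrightarrow>
          efac (q ^ 2) p (q ^ 2 * x i / x j) (n i) \<noteq> 0"
    and generic_theta: "\<And>i. i \<in> {1..r} \<Longrightarrow> theta p (a * x i) \<noteq> 0"
    and generic_ax: "\<And>i. i \<in> {1..r} \<Longrightarrow>
          efac q p (a * x i * q ^ (2 * n i + 1)) (weight r n) \<noteq> 0"
    and generic_abx: "\<And>i. i \<in> {1..r} \<Longrightarrow>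
          efacs (q ^ 2) p [a * x i * q ^ 2 / b, a * b * x i * q] (n i) \<noteq> 0"
  shows
    "(\<Sum>k \<in> (\<Pi>\<^sub>E i\<in>{1..r}. {0..n i}).
        Delta r p (\<lambda>i. x i * q ^ (2 * k i)) / Delta r p x
        * (efacs q p [b, q / b] (weight r k) / efacs q p [a * q / c, a * q / d] (weight r k))
        * q ^ weight r k
        * (\<Prod>i=1..r. \<Prod>j=1..r.
             efac (q ^ 2) p (q powi (- 2 * int (n j)) * x i / x j) (k i)
             / efac (q ^ 2) p (q ^ 2 * x i / x j) (k i))
        * (\<Prod>i=1..r.
             theta p (a * x i * q ^ (weight r k + 2 * k i)) / theta p (a * x i)
             * (efac q p (a * x i) (weight r k)
                / efac q p (a * x i * q ^ (2 * n i + 1)) (weight r k))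
             * (efacs (q ^ 2) p [c * x i, d * x i] (k i)
                / efacs (q ^ 2) p [a * x i * q ^ 2 / b, a * b * x i * q] (k i))))
     = efacs (q ^ 2) p [a * q ^ 2 / (b * c), a * b * q / c] (weight r n)
       / efac q p (a * q / c) (2 * weight r n)
       * (\<Prod>i=1..r.
            efac q p (a * x i * q) (2 * n i)
            / efacs (q ^ 2) p [a * x i * q ^ 2 / b, a * b * x i * q] (n i))"
proof -
  define N where "N = weight r n"
  define D where "D = (\<lambda>z. z\<^sup>2 * q ^ (2 * N + 1) / c)"
  define K where "K = (\<Pi>\<^sub>E i\<in>{1..r}. {0..n i})"
  have Da: "D a = d" using balancing nonzero by (simp add: D_def N_def field_simps)
  \<comment> \<open>Each w in \<open>M1\<close> excludes the z with theta(z w) = 0, each w in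
    \<open>M2\<close> those with theta(z^2 w) = 0. The families x_i / b and b x_i keep
    \<open>bden\<close> nonzero; the others are the conditions of \<open>generic_params\<close> that
    involve z.\<close>
  define M1 where "M1 = (\<lambda>(i, k). x i * q powi k) ` ({1..r} \<times> UNIV) \<union> range (\<lambda>k. 1 / c * q powi k)
    \<union> (\<lambda>(i, k). x i / b * q powi k) ` ({1..r} \<times> UNIV) \<union> (\<lambda>(i, k). b * x i * q powi k) ` ({1..r} \<times> UNIV)"
  define M2 where "M2 = (\<lambda>(i, j, k). x i * x j * q powi k) ` ({1..r} \<times> {1..r} \<times> UNIV)"
  define S where "S = insert 0 ((\<Union>w\<in>M1. {z. theta p (z * w) = 0}) \<union> (\<Union>w\<in>M2. {z. theta p (z\<^sup>2 * w) = 0}))"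
  have "countable S"
  proof -
    have "countable M1" "countable M2"
      unfolding M1_def M2_def by (intro countable_Un countable_image countable_SIGMA countableI_type; simp)+
    moreover have "w \<noteq> 0" if "w \<in> M1 \<union> M2" for w
      using that nonzero q(1) unfolding M1_def M2_def by auto
    ultimately show ?thesis
      unfolding S_def using countable_theta_scaled_zeros[OF p]
      by (intro countable_insert countable_Un countable_UN) auto
  qed
  moreover have "(\<Sum>k\<in>K. summand p q r c (D z) z b x n k) = closed_form p q r c z b x n" if z: "z \<notin> S" for z
  proof -
    have z0: "z \<noteq> 0" and S1: "\<And>w. w \<in> M1 \<Longrightarrow> theta p (z * w) \<noteq> 0" and S2: "\<And>w. w \<in> M2 \<Longrightarrow> theta p (z\<^sup>2 * w) \<noteq> 0"
      using z unfolding S_def by auto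
    have g1: "theta p (z * x i * q powi k) \<noteq> 0" "theta p (z * x i / b * q powi k) \<noteq> 0"
      "theta p (z * b * x i * q powi k) \<noteq> 0" if i: "i \<in> {1..r}" for i k
    proof -
      have "x i * q powi k \<in> M1" "x i / b * q powi k \<in> M1" "b * x i * q powi k \<in> M1"
        unfolding M1_def using i by (force intro: image_eqI[of _ _ "(i, k)"])+
      from this[THEN S1] show "theta p (z * x i * q powi k) \<noteq> 0" "theta p (z * x i / b * q powi k) \<noteq> 0"
        "theta p (z * b * x i * q powi k) \<noteq> 0"
        by (simp_all add: mult.assoc)
    qed
    have g2: "theta p (z\<^sup>2 * x i * x j * q powi k) \<noteq> 0" if "i \<in> {1..r}" "j \<in> {1..r}" for i j k
    proof -
      have "x i * x j * q powi k \<in> M2"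
        unfolding M2_def using that by (force intro: image_eqI[of _ _ "(i, j, k)"])
      from S2[OF this] show ?thesis by (simp add: mult.assoc)
    qed
    have g3: "theta p (z / c * q powi k) \<noteq> 0" for k
    proof -
      have "1 / c * q powi k \<in> M1" unfolding M1_def by blast
      from S1[OF this] show ?thesis by simp
    qed
    have Dz: "D z \<noteq> 0" "z\<^sup>2 * q ^ (2 * weight r n + 1) = c * D z"
      using z0 q(1) nonzero by (simp_all add: D_def N_def)
    have "bden p q r z x n b \<noteq> 0"
    proof -
      have "efac (q\<^sup>2) p (z * x i * q\<^sup>2 / b) (n i) \<noteq> 0" "efac (q\<^sup>2) p (z * b * x i * q) (n i) \<noteq> 0" if i: "i \<in> {1..r}" for i
        using theta_generic_efac(2)[OF p q(1) g1(2)[OF i], of 2 "n i"] theta_generic_efac(2)[OF p q(1) g1(3)[OF i], of 1 "n i"]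
        by simp_all
      then show ?thesis
        unfolding bden_def[OF p q(1) nonzero(3) Dz(1)] by simp
    qed
    moreover have "generic_params p q r c z x n"
      unfolding generic_params_def
      using nonzero(5) g1(1) g2 g3 ratio_generic[OF p q nonzero(5) generic_Delta generic_xx] by auto
    ultimately show ?thesis
      unfolding K_def using identity_generic[OF p q(1) nonzero(3) Dz(1) q(2) _ z0 nonzero(2) Dz(2)] by blast
  qed
  \<comment> \<open>At \<open>a\<close> itself only the nonvanishing assumed in the theorem is
    available. It suffices for continuity, since the denominators of length |k| or k_i divide those
    of maximal length.\<close>
  moreover have "isCont (\<lambda>z. \<Sum>k\<in>K. summand p q r c (D z) z b x n k) a"
  proof (intro continuous_sum)
    fix k assume "k \<in> K"
    then have k: "k i \<le> n i" if "i \<in> {1..r}" for i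
      using that by (auto simp: K_def dest: PiE_mem)
    have Wk: "weight r k \<le> weight r n"
      unfolding weight_def using k by (intro sum_mono) auto
    have contD: "isCont D a" unfolding D_def using nonzero by (intro continuous_intros) auto
    have ne: "efac q p (a * q / c) (weight r k) \<noteq> 0" "efac q p (a * q / D a) (weight r k) \<noteq> 0"
      using generic_acd efac_nonzero_le[OF _ Wk] by (auto simp: efacs_pair Da)
    have ne': "efac q p (a * x i * q ^ (2 * n i + 1)) (weight r k) \<noteq> 0" "theta p (a * x i) \<noteq> 0"
      "efac (q\<^sup>2) p (a * x i * q\<^sup>2 / b) (k i) \<noteq> 0" "efac (q\<^sup>2) p (a * b * x i * q) (k i) \<noteq> 0" if i: "i \<in> {1..r}" for i
      using generic_ax[OF i] generic_theta[OF i] generic_abx[OF i] efac_nonzero_le[OF _ Wk] efac_nonzero_le[OF _ k[OF i]]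
      by (auto simp: efacs_pair)
    show "isCont (\<lambda>z. summand p q r c (D z) z b x n k) a"
      unfolding summand_def efacs_pair
      using nonzero q(1) ne ne' Da
      by (intro continuous_intros isCont_efac[OF p] isCont_theta[OF p] contD) auto
  qed
  moreover have "isCont (\<lambda>z. closed_form p q r c z b x n) a"
    unfolding closed_form_def efacs_pair
    using nonzero q(1) generic_ac generic_abx
    by (intro continuous_intros isCont_efac[OF p]) (auto simp: efacs_pair)
  ultimately have "(\<Sum>k\<in>K. summand p q r c (D a) a b x n k) = closed_form p q r c a b x n"
    using continuous_eq_off_countable[of S "\<lambda>z. \<Sum>k\<in>K. summand p q r c (D z) z b x n k"
        "\<lambda>z. closed_form p q r c z b x n" a] by blast
  then show ?thesis
    unfolding Da summand_def closed_form_def K_def .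
qed

end
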